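(* Let $n\ge1$, $N\ge 1$ be integers and let $k_1,\dots,k_N$ be positive integers with $\sum_{j=1}^{N}k_j\le n$. Let $A_1,\dots,A_N$ be pairwise disjoint subsets of the set of coordinate variables $\{x_1,\dots,x_n\}$ of $\mathbb{R}^n$ such that $A_j$ has exactly $k_j$ elements, and put $$r_j=\Big(\sum_{x_m\in A_j}x_m^2\Big)^{1/2},\qquad 1\le j\le N .$$ Suppose that $1<p<\infty$ and $0<\alpha_j<\frac{k_j}{p}$ for $1\le j\le N$. Then there is a constant $C$, independent of $f$, such that for all $f\in C_0^\infty(\mathbb{R}^n)$ $$\left\|\frac{f(x_1,\dots,x_n)}{\prod_{j=1}^{N}|r_j|^{\alpha_j}}\right\|_{L^p(\mathbb{R}^n)}\le C\left\|\Lambda_{A}^{\sum_{j=1}^{N}\alpha_j}f\right\|_{L^p(\mathbb{R}^n)},$$ where $A=\bigcup_{j=1}^{N}A_j$ and $\Lambda_A^{\sigma}$ is the fractional derivative of order $\sigma$ in the variables belonging to $A$.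
   Context: Fourier transform on $\mathbb{R}^n$: $\hat f(\xi)=(2\pi)^{-n/2}\int_{\mathbb{R}^n}f(x)e^{-i\xi\cdot x}\,dx$. For a set $A$ of coordinate variables and $\sigma\ge0$, the partial fractional derivative $\Lambda_A^\sigma$ is defined by $$\widehat{\Lambda_A^{\sigma}f}(\xi)=\Big(\sum_{m:\,x_m\in A}|\xi_m|^2\Big)^{\sigma/2}\hat f(\xi).$$ *)

theory Defs
  imports "HOL-Analysis.Analysis"
begin

text \<open>
  Functions on \<open>\<real>\<^sup>n\<close> have type \<open>real ^ 'n \<Rightarrow> complex\<close> with \<open>n = CARD('n)\<close>; a set of coordinate
  variables is represented by its index set, of type \<open>'n set\<close>.
\<close>

text \<open>\<open>f\<close> is of class \<open>C\<^sup>k\<close> on the whole space: iterated directional derivatives of all orders up to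
  \<open>k\<close> exist as total derivatives, and those of order \<open>k\<close> are continuous.\<close>

fun times_cont_diff :: "nat \<Rightarrow> ('a::real_normed_vector \<Rightarrow> 'b::real_normed_vector) \<Rightarrow> bool" where
  "times_cont_diff 0 f \<longleftrightarrow> continuous_on UNIV f"
| "times_cont_diff (Suc k) f \<longleftrightarrow>
     (\<forall>x. f differentiable (at x)) \<and>
     (\<forall>v. times_cont_diff k (\<lambda>x. frechet_derivative f (at x) v))"

definition test_function :: "(real ^ 'n::finite \<Rightarrow> complex) \<Rightarrow> bool" where
  "test_function f \<longleftrightarrow>
     (\<forall>k. times_cont_diff k f) \<and> compact (closure (support_on UNIV f))"

text \<open>The \<open>L\<^sup>p\<close> norm takes the value \<open>\<infinity>\<close> when \<open>\<integral>|f|\<^sup>p\<close> diverges.\<close>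

definition Lp_norm :: "real \<Rightarrow> (real ^ 'n::finite \<Rightarrow> complex) \<Rightarrow> ennreal" where
  "Lp_norm p f =
     (let I = (\<integral>\<^sup>+x. ennreal (norm (f x) powr p) \<partial>lborel)
      in if I = \<infinity> then \<infinity> else ennreal (enn2real I powr (1 / p)))"

definition fourier :: "(real ^ 'n::finite \<Rightarrow> complex) \<Rightarrow> real ^ 'n \<Rightarrow> complex" where
  "fourier f \<xi> =
     complex_of_real ((2 * pi) powr (- real CARD('n) / 2)) *
     (LINT x|lborel. f x * exp (- \<i> * complex_of_real (\<xi> \<bullet> x)))"

definition inverse_fourier :: "(real ^ 'n::finite \<Rightarrow> complex) \<Rightarrow> real ^ 'n \<Rightarrow> complex" where
  "inverse_fourier g x =
     complex_of_real ((2 * pi) powr (- real CARD('n) / 2)) *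
     (LINT \<xi>|lborel. g \<xi> * exp (\<i> * complex_of_real (\<xi> \<bullet> x)))"

text \<open>
  The symbol \<open>(\<Sum>\<^sub>m |\<xi>\<^sub>m|\<^sup>2)\<^bsup>\<sigma>/2\<^esup>\<close>, \<open>\<sigma> \<ge> 0\<close>. Since \<open>0 powr 0 = 0\<close> in HOL, the order \<open>\<sigma> = 0\<close>
  (the identity operator) is treated separately.
\<close>

definition partial_symbol :: "'n::finite set \<Rightarrow> real \<Rightarrow> real ^ 'n \<Rightarrow> real" where
  "partial_symbol A \<sigma> \<xi> = (if \<sigma> = 0 then 1 else (\<Sum>m\<in>A. \<bar>\<xi> $ m\<bar>\<^sup>2) powr (\<sigma> / 2))"

text \<open>
  The partial fractional derivative: the function whose Fourier transform is the symbol times the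
  Fourier transform of \<open>f\<close>. For a test function \<open>f\<close> this product is integrable, so the inverse
  transform is given by an absolutely convergent integral.
\<close>

definition frac_deriv ::
    "'n::finite set \<Rightarrow> real \<Rightarrow> (real ^ 'n \<Rightarrow> complex) \<Rightarrow> real ^ 'n \<Rightarrow> complex" where
  "frac_deriv A \<sigma> f =
     inverse_fourier (\<lambda>\<xi>. complex_of_real (partial_symbol A \<sigma> \<xi>) * fourier f \<xi>)"

definition block_radius :: "'n::finite set \<Rightarrow> real ^ 'n \<Rightarrow> real" where
  "block_radius A x = sqrt (\<Sum>m\<in>A. (x $ m)\<^sup>2)"

end

theory Submission
  imports Defs "HOL-Probability.Probability"
begin

text \<open>
  Write \<open>B = \<Union>\<^sub>j A\<^sub>j\<close>, \<open>d = card B\<close>, \<open>\<sigma> = \<Sum>\<^sub>j \<alpha>\<^sub>j\<close>, and let \<open>g\<close> be the fractional derivative of \<open>f\<close> of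
  order \<open>\<sigma>\<close> in the variables of \<open>B\<close>. Since \<open>\<sigma> < d\<close>, the function \<open>f\<close> is the Riesz potential of \<open>g\<close> of
  order \<open>\<sigma>\<close> in these variables, that is, up to a constant, the partial convolution of \<open>g\<close> with
  \<open>|z\<^sub>B|\<^bsup>\<sigma> - d\<^esup>\<close>. To see this without a theory of homogeneous distributions, write the inverse symbol as a
  mixture of Gaussians, \<open>|\<xi>\<^sub>B|\<^bsup>-\<sigma>\<^esup> = c \<integral> s\<^bsup>\<sigma> - 1\<^esup> exp (- s\<^sup>2 |\<xi>\<^sub>B|\<^sup>2 / 2) ds\<close> over \<open>s > 0\<close>. Fourier inversion
  and Fubini then bound \<open>|f|\<close> by the corresponding mixture of Gaussian means of \<open>|g|\<close>
  (\<open>riesz_potential_bound\<close>), and integrating the Gaussians in \<open>s\<close> gives the Riesz kernel.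

  The theorem for general blocks follows from blocks with a single variable. All exponents involved are
  negative, and \<open>|z\<^sub>B| \<ge> |z\<^sub>m|\<close> and \<open>r\<^sub>j \<ge> |x\<^sub>m|\<close> for \<open>m\<close> in \<open>B\<close> and in \<open>A\<^sub>j\<close> respectively. Hence, with
  \<open>\<gamma>\<^sub>m = \<alpha>\<^sub>j / k\<^sub>j\<close> for \<open>m \<in> A\<^sub>j\<close>, the kernel \<open>|z\<^sub>B|\<^bsup>\<sigma> - d\<^esup>\<close> is at most \<open>\<Prod>\<^sub>m |z\<^sub>m|\<^bsup>\<gamma>\<^sub>m - 1\<^esup>\<close> and the weight
  \<open>\<Prod>\<^sub>j r\<^sub>j\<^bsup>-\<alpha>\<^sub>j\<^esup>\<close> is at most \<open>\<Prod>\<^sub>m |x\<^sub>m|\<^bsup>-\<gamma>\<^sub>m\<^esup>\<close>, the products being over \<open>m \<in> B\<close>. Nothing is lost: the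
  hypothesis \<open>\<alpha>\<^sub>j < k\<^sub>j / p\<close> says exactly that \<open>\<gamma>\<^sub>m < 1 / p\<close>.

  What remains is the weighted \<open>L\<^sup>p\<close> bound for a product kernel (\<open>weighted_riesz_gauss_bound\<close>), a
  Stein-Weiss inequality. It is Schur's test with the weight \<open>\<Prod>\<^sub>m |x\<^sub>m|\<^bsup>-1/p\<^esup>\<close>: all integrals that occur
  factor over the coordinates, and each factor is \<open>\<integral> |u|\<^bsup>\<gamma> - 1\<^esup> |x - u|\<^bsup>-b\<^esup> du = C |x|\<^bsup>\<gamma> - b\<^esup>\<close>, which
  holds by scaling.

  Partial convolutions are written as integrals over the whole space \<open>real ^ 'n\<close>: the kernel carries an
  additional Gaussian probability density in the variables outside \<open>B\<close>, and \<open>g\<close> is shifted only by the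
  projection \<open>coord_proj B y\<close>, so these variables integrate out to \<open>1\<close>.
\<close>

section \<open>Integrals of powers and Gaussians on the real line\<close>

lemma nn_integral_powr_near_0:
  fixes a c :: real
  assumes "a > -1" "c > 0"
  shows "(\<integral>\<^sup>+u. ennreal (\<bar>u\<bar> powr a) * indicator {-c..c} u \<partial>lborel) < \<infinity>"
proof -
  have pos: "(\<integral>\<^sup>+u. ennreal (\<bar>u\<bar> powr a) * indicator {0..c} u \<partial>lborel) < \<infinity>"
  proof -
    have "((\<lambda>u. \<bar>u\<bar> powr a) has_integral (c powr (a+1) / (a+1))) {0..c}"
      using has_integral_powr_from_0[OF assms(1), of c] assms(2)
      by (subst has_integral_cong[where g="\<lambda>u. u powr a"]) auto
    then have "(\<integral>\<^sup>+u. ennreal (\<bar>u\<bar> powr a) * indicator {0..c} u \<partial>lborel) = ennreal (c powr (a+1) / (a+1))"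
      by (intro nn_integral_has_integral_lebesgue') auto
    then show ?thesis by simp
  qed
  have neg: "(\<integral>\<^sup>+u. ennreal (\<bar>u\<bar> powr a) * indicator {-c..0} u \<partial>lborel)
      = (\<integral>\<^sup>+u. ennreal (\<bar>u\<bar> powr a) * indicator {0..c} u \<partial>lborel)"
    by (subst nn_integral_real_affine[where c="-1" and t=0])
       (auto intro!: nn_integral_cong simp: indicator_def)
  have "(\<integral>\<^sup>+u. ennreal (\<bar>u\<bar> powr a) * indicator {-c..c} u \<partial>lborel)
     \<le> (\<integral>\<^sup>+u. ennreal (\<bar>u\<bar> powr a) * indicator {-c..0} u
          + ennreal (\<bar>u\<bar> powr a) * indicator {0..c} u \<partial>lborel)"
    by (intro nn_integral_mono) (auto simp: indicator_def)
  also have "\<dots> < \<infinity>"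
    by (subst nn_integral_add) (use pos neg in auto)
  finally show ?thesis .
qed

lemma nn_integral_powr_at_top:
  fixes a c :: real
  assumes "a < -1" "c > 0"
  shows "(\<integral>\<^sup>+u. ennreal (u powr a) * indicator {c..} u \<partial>lborel) < \<infinity>"
proof -
  have "((\<lambda>u. u powr a) has_integral - (c powr (a+1)) / (a+1)) {c..}"
    using has_integral_powr_to_inf assms by blast
  then have "(\<integral>\<^sup>+u. ennreal (u powr a) * indicator {c..} u \<partial>lborel) = ennreal (- (c powr (a+1)) / (a+1))"
    by (intro nn_integral_has_integral_lebesgue') auto
  then show ?thesis by simp
qed

lemma nn_integral_powr_away_0:
  fixes a c :: real
  assumes "a < -1" "c > 0"
  shows "(\<integral>\<^sup>+u. ennreal (\<bar>u\<bar> powr a) * indicator {u. c \<le> \<bar>u\<bar>} u \<partial>lborel) < \<infinity>"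
proof -
  have pos: "(\<integral>\<^sup>+u. ennreal (\<bar>u\<bar> powr a) * indicator {c..} u \<partial>lborel) < \<infinity>"
  proof -
    have "(\<integral>\<^sup>+u. ennreal (\<bar>u\<bar> powr a) * indicator {c..} u \<partial>lborel)
       = (\<integral>\<^sup>+u. ennreal (u powr a) * indicator {c..} u \<partial>lborel)"
      using assms(2) by (intro nn_integral_cong) (auto simp: indicator_def)
    then show ?thesis using nn_integral_powr_at_top[OF assms] by simp
  qed
  have neg: "(\<integral>\<^sup>+u. ennreal (\<bar>u\<bar> powr a) * indicator {..-c} u \<partial>lborel)
      = (\<integral>\<^sup>+u. ennreal (\<bar>u\<bar> powr a) * indicator {c..} u \<partial>lborel)"
    by (subst nn_integral_real_affine[where c="-1" and t=0])
       (auto intro!: nn_integral_cong simp: indicator_def)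
  have "(\<integral>\<^sup>+u. ennreal (\<bar>u\<bar> powr a) * indicator {u. c \<le> \<bar>u\<bar>} u \<partial>lborel)
     \<le> (\<integral>\<^sup>+u. ennreal (\<bar>u\<bar> powr a) * indicator {..-c} u
          + ennreal (\<bar>u\<bar> powr a) * indicator {c..} u \<partial>lborel)"
    by (intro nn_integral_mono) (auto simp: indicator_def)
  also have "\<dots> < \<infinity>"
    by (subst nn_integral_add) (use pos neg in auto)
  finally show ?thesis .
qed

text \<open>
  The singularities at \<open>0\<close> and \<open>1\<close> are integrable because \<open>0 < g\<close> and \<open>b < 1\<close>; at infinity the
  integrand is comparable to \<open>|u|\<^bsup>g - 1 - b\<^esup>\<close>, integrable because \<open>g < b\<close>.
\<close>

lemma nn_integral_powr_convolution_finite: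
  fixes g b :: real
  assumes "0 < g" "g < b" "b < 1"
  shows "(\<integral>\<^sup>+u. ennreal (\<bar>u\<bar> powr (g - 1) * \<bar>1 - u\<bar> powr (-b)) \<partial>lborel) < \<infinity>"
proof -
  let ?A = "\<lambda>u::real. ennreal (\<bar>u\<bar> powr (g-1)) * indicator {-2..2} u"
  let ?B = "\<lambda>u::real. ennreal (\<bar>u\<bar> powr (-b)) * indicator {-2..2} u"
  let ?D = "\<lambda>u::real. ennreal (\<bar>u\<bar> powr (g-1-b)) * indicator {u. 2 \<le> \<bar>u\<bar>} u"
  have A: "(\<integral>\<^sup>+u. ?A u \<partial>lborel) < \<infinity>" and B: "(\<integral>\<^sup>+u. ?B u \<partial>lborel) < \<infinity>"
    using assms by (auto intro!: nn_integral_powr_near_0[simplified])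
  have B': "(\<integral>\<^sup>+u. ?B (1 - u) \<partial>lborel) = (\<integral>\<^sup>+u. ?B u \<partial>lborel)"
    by (subst (2) nn_integral_real_affine[where c="-1" and t=1]) auto
  have D: "(\<integral>\<^sup>+u. ?D u \<partial>lborel) < \<infinity>"
    using nn_integral_powr_away_0[of "g-1-b" 2] assms by simp
  have "(\<integral>\<^sup>+u. ennreal (\<bar>u\<bar> powr (g - 1) * \<bar>1 - u\<bar> powr (-b)) \<partial>lborel)
    \<le> (\<integral>\<^sup>+u. ennreal (2 powr b) * ?A u + ennreal (2 powr (1 - g)) * ?B (1 - u)
          + ennreal (2 powr b) * ?D u \<partial>lborel)"
  proof (rule nn_integral_mono)
    fix u :: real
    have half: "v powr (-e) \<le> 2 powr e * w powr (-e)" if "w > 0" "w / 2 \<le> v" "e \<ge> 0" for v w e :: real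
    proof -
      have "v powr (-e) \<le> (w/2) powr (-e)" using that by (intro powr_mono2') auto
      also have "\<dots> = 2 powr e * w powr (-e)" using that by (simp add: powr_divide powr_minus field_simps)
      finally show ?thesis .
    qed
    consider "\<bar>1 - u\<bar> \<ge> 1/2" "\<bar>u\<bar> \<le> 2" | "\<bar>1 - u\<bar> < 1/2" | "\<bar>u\<bar> > 2" by linarith
    then show "ennreal (\<bar>u\<bar> powr (g - 1) * \<bar>1 - u\<bar> powr (-b))
        \<le> ennreal (2 powr b) * ?A u + ennreal (2 powr (1 - g)) * ?B (1 - u) + ennreal (2 powr b) * ?D u"
    proof cases
      case 1
      have "\<bar>1 - u\<bar> powr (-b) \<le> 2 powr b" using half[of 1 "\<bar>1-u\<bar>" b] 1 assms by simp
      then have "\<bar>u\<bar> powr (g - 1) * \<bar>1 - u\<bar> powr (-b) \<le> 2 powr b * \<bar>u\<bar> powr (g - 1)"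
        by (metis mult.commute mult_right_mono powr_ge_zero)
      then have "ennreal (\<bar>u\<bar> powr (g - 1) * \<bar>1 - u\<bar> powr (-b)) \<le> ennreal (2 powr b) * ?A u"
        using 1 by (simp add: indicator_def abs_le_iff flip: ennreal_mult)
      then show ?thesis by (simp add: add.assoc add_increasing2)
    next
      case 2
      have u: "1/2 < u" "u < 3/2" using 2 by linarith+
      have "\<bar>u\<bar> powr (g - 1) \<le> 2 powr (1 - g)" using half[of 1 "\<bar>u\<bar>" "1-g"] 2 assms by (simp add: abs_if split: if_splits)
      then have le: "\<bar>u\<bar> powr (g - 1) * \<bar>1 - u\<bar> powr (-b) \<le> 2 powr (1 - g) * \<bar>1 - u\<bar> powr (-b)"
        by (intro mult_right_mono) auto
      have "?B (1 - u) = ennreal (\<bar>1 - u\<bar> powr (-b))"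
        using u by (simp add: indicator_def)
      with ennreal_leI[OF le] have "ennreal (\<bar>u\<bar> powr (g - 1) * \<bar>1 - u\<bar> powr (-b)) \<le> ennreal (2 powr (1 - g)) * ?B (1 - u)"
        by (simp only: ennreal_mult powr_ge_zero)
      then show ?thesis by (simp add: add.assoc add_increasing add_increasing2)
    next
      case 3
      have "\<bar>1 - u\<bar> powr (-b) \<le> 2 powr b * \<bar>u\<bar> powr (-b)" 
      proof (rule half)
        show "\<bar>u\<bar> > 0" "\<bar>u\<bar> / 2 \<le> \<bar>1 - u\<bar>" "b \<ge> 0" using 3 assms by linarith+
      qed
      then have "\<bar>u\<bar> powr (g - 1) * \<bar>1 - u\<bar> powr (-b) \<le> 2 powr b * (\<bar>u\<bar> powr (g - 1) * \<bar>u\<bar> powr (-b))"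
        by (metis mult.left_commute mult_left_mono powr_ge_zero)
      also have "\<bar>u\<bar> powr (g - 1) * \<bar>u\<bar> powr (-b) = \<bar>u\<bar> powr (g - 1 - b)"
        by (simp flip: powr_add)
      finally have "ennreal (\<bar>u\<bar> powr (g - 1) * \<bar>1 - u\<bar> powr (-b)) \<le> ennreal (2 powr b) * ?D u"
        using 3 by (simp add: indicator_def flip: ennreal_mult)
      then show ?thesis by (simp add: add_increasing)
    qed
  qed
  also have "\<dots> = ennreal (2 powr b) * (\<integral>\<^sup>+u. ?A u \<partial>lborel) + ennreal (2 powr (1 - g)) * (\<integral>\<^sup>+u. ?B (1 - u) \<partial>lborel)
          + ennreal (2 powr b) * (\<integral>\<^sup>+u. ?D u \<partial>lborel)"
    by (simp add: nn_integral_add nn_integral_cmult)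
  also have "\<dots> < \<infinity>"
    using A B D B' by (simp add: ennreal_mult_less_top)
  finally show ?thesis .
qed

text \<open>
  The substitution \<open>u \<mapsto> x u\<close> reduces this to \<open>x = 1\<close>.
\<close>

lemma nn_integral_powr_convolution:
  fixes g b :: real
  assumes "0 < g" "g < b" "b < 1"
  obtains C :: real where "C > 0"
    "\<And>x. x \<noteq> 0 \<Longrightarrow> (\<integral>\<^sup>+u. ennreal (\<bar>u\<bar> powr (g - 1) * \<bar>x - u\<bar> powr (-b)) \<partial>lborel)
        \<le> ennreal (C * \<bar>x\<bar> powr (g - b))"
proof -
  let ?I = "\<integral>\<^sup>+u. ennreal (\<bar>u\<bar> powr (g - 1) * \<bar>1 - u\<bar> powr (-b)) \<partial>lborel"
  define C where "C = enn2real ?I + 1"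
  have I: "?I \<le> ennreal C" "C > 0"
    using nn_integral_powr_convolution_finite[OF assms]
    by (auto simp: C_def ennreal_plus add_increasing2 add_nonneg_pos simp flip: top.not_eq_extremum)
  show ?thesis
  proof (rule that[OF I(2)])
    fix x :: real assume x: "x \<noteq> 0"
    have eq: "ennreal (\<bar>x * u\<bar> powr (g - 1) * \<bar>x - x * u\<bar> powr (-b))
       = ennreal (\<bar>x\<bar> powr (g - 1 - b)) * ennreal (\<bar>u\<bar> powr (g - 1) * \<bar>1 - u\<bar> powr (-b))" for u
    proof -
      have "\<bar>x - x * u\<bar> = \<bar>x\<bar> * \<bar>1 - u\<bar>" by (simp add: algebra_simps flip: abs_mult)
      moreover have "\<bar>x\<bar> powr (g - 1) * \<bar>x\<bar> powr (-b) = \<bar>x\<bar> powr (g - 1 - b)"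
        by (simp flip: powr_add)
      moreover have "\<bar>x * u\<bar> powr (g - 1) * (\<bar>x\<bar> * \<bar>1 - u\<bar>) powr (-b)
          = (\<bar>x\<bar> powr (g - 1) * \<bar>x\<bar> powr (-b)) * (\<bar>u\<bar> powr (g - 1) * \<bar>1 - u\<bar> powr (-b))"
        by (simp only: abs_mult powr_mult abs_ge_zero ac_simps)
      ultimately show ?thesis
        by (simp only: ennreal_mult powr_ge_zero mult_nonneg_nonneg)
    qed
    have "(\<integral>\<^sup>+u. ennreal (\<bar>u\<bar> powr (g - 1) * \<bar>x - u\<bar> powr (-b)) \<partial>lborel)
       = ennreal \<bar>x\<bar> * (ennreal (\<bar>x\<bar> powr (g - 1 - b)) * ?I)"
      by (subst nn_integral_real_affine[where c=x and t=0]) (use x eq in \<open>simp_all add: nn_integral_cmult\<close>)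
    also have "\<dots> \<le> ennreal \<bar>x\<bar> * (ennreal (\<bar>x\<bar> powr (g - 1 - b)) * ennreal C)"
      by (intro mult_left_mono I) auto
    also have "\<dots> = ennreal (C * (\<bar>x\<bar> powr 1 * \<bar>x\<bar> powr (g - 1 - b)))"
      using x I by (simp add: ac_simps flip: ennreal_mult)
    also have "\<bar>x\<bar> powr 1 * \<bar>x\<bar> powr (g - 1 - b) = \<bar>x\<bar> powr (g - b)"
      by (subst powr_add[symmetric]) simp
    finally show "(\<integral>\<^sup>+u. ennreal (\<bar>u\<bar> powr (g - 1) * \<bar>x - u\<bar> powr (-b)) \<partial>lborel)
        \<le> ennreal (C * \<bar>x\<bar> powr (g - b))" .
  qed
qed

text \<open>
  From \<open>ln v \<le> v\<close> and \<open>M v - v\<^sup>2 / 2 \<le> M\<^sup>2 / 2\<close>.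
\<close>

lemma powr_gaussian_bounded:
  fixes M v :: real
  assumes "M \<ge> 0" "v > 0"
  shows "v powr M * exp (- v\<^sup>2 / 2) \<le> exp (M\<^sup>2 / 2)"
proof -
  have "v powr M * exp (- v\<^sup>2 / 2) = exp (M * ln v - v\<^sup>2 / 2)"
    using assms by (simp add: powr_def flip: exp_add)
  also have "M * ln v \<le> M * v" using assms by (meson ln_bound mult_left_mono)
  then have "M * ln v - v\<^sup>2 / 2 \<le> M * v - v\<^sup>2 / 2" by simp
  also have "\<dots> \<le> M\<^sup>2 / 2" using sum_squares_bound[of M v] by simp
  finally show ?thesis by simp
qed

lemma gaussian_moment_finite:
  fixes s :: real
  assumes "s > 0"
  shows "(\<integral>\<^sup>+u. ennreal (u powr (s - 1) * exp (- u\<^sup>2 / 2)) * indicator {0<..} u \<partial>lborel) < \<infinity>"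
proof -
  have A: "(\<integral>\<^sup>+u. ennreal (\<bar>u\<bar> powr (s-1)) * indicator {-1..1} u \<partial>lborel) < \<infinity>"
    using nn_integral_powr_near_0[of "s-1" 1] assms by simp
  have B: "(\<integral>\<^sup>+u. ennreal (u powr (-2)) * indicator {1::real..} u \<partial>lborel) < \<infinity>"
    by (rule nn_integral_powr_at_top) auto
  have "(\<integral>\<^sup>+u. ennreal (u powr (s - 1) * exp (- u\<^sup>2 / 2)) * indicator {0<..} u \<partial>lborel)
    \<le> (\<integral>\<^sup>+u. ennreal (\<bar>u\<bar> powr (s-1)) * indicator {-1..1} u
          + ennreal (exp ((s+1)\<^sup>2/2)) * (ennreal (u powr (-2)) * indicator {1::real..} u) \<partial>lborel)"
  proof (rule nn_integral_mono)
    fix u :: real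
    consider "u \<le> 0" | "0 < u" "u \<le> 1" | "1 < u" by linarith
    then show "ennreal (u powr (s - 1) * exp (- u\<^sup>2 / 2)) * indicator {0<..} u
      \<le> ennreal (\<bar>u\<bar> powr (s-1)) * indicator {-1..1} u
          + ennreal (exp ((s+1)\<^sup>2/2)) * (ennreal (u powr (-2)) * indicator {1..} u)"
    proof cases
      case 2
      have "u powr (s - 1) * exp (- u\<^sup>2 / 2) \<le> u powr (s - 1)" by (simp add: mult_left_le)
      then show ?thesis using 2 by (simp add: add_increasing2)
    next
      case 3
      have "u powr (s - 1) * exp (- u\<^sup>2 / 2) = u powr (s + 1) * exp (- u\<^sup>2 / 2) * u powr (-2)"
        using 3 by (simp add: mult.commute mult.left_commute flip: powr_add)
      also have "\<dots> \<le> exp ((s+1)\<^sup>2/2) * u powr (-2)"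
        using 3 assms by (intro mult_right_mono powr_gaussian_bounded) auto
      finally show ?thesis using 3 by (simp flip: ennreal_mult)
    qed auto
  qed
  also have "\<dots> < \<infinity>"
    using A B by (subst nn_integral_add; simp add: nn_integral_cmult ennreal_mult_less_top)
  finally show ?thesis .
qed

lemma inverse_gaussian_moment_finite:
  fixes a :: real
  assumes "a > 0"
  shows "(\<integral>\<^sup>+u. ennreal (u powr (- a - 1) * exp (- 1 / (2 * u\<^sup>2))) * indicator {0<..} u \<partial>lborel) < \<infinity>"
proof -
  have A: "(\<integral>\<^sup>+u. ennreal (\<bar>u::real\<bar> powr 0) * indicator {-1..1} u \<partial>lborel) < \<infinity>"
    by (rule nn_integral_powr_near_0) auto
  have B: "(\<integral>\<^sup>+u. ennreal (u powr (-a - 1)) * indicator {1::real..} u \<partial>lborel) < \<infinity>"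
    using assms by (intro nn_integral_powr_at_top) auto
  have "(\<integral>\<^sup>+u. ennreal (u powr (- a - 1) * exp (- 1 / (2 * u\<^sup>2))) * indicator {0<..} u \<partial>lborel)
    \<le> (\<integral>\<^sup>+u. ennreal (exp ((a+1)\<^sup>2/2)) * (ennreal (\<bar>u::real\<bar> powr 0) * indicator {-1..1} u)
          + ennreal (u powr (-a-1)) * indicator {1::real..} u \<partial>lborel)"
  proof (rule nn_integral_mono)
    fix u :: real
    consider "u \<le> 0" | "0 < u" "u \<le> 1" | "1 < u" by linarith
    then show "ennreal (u powr (- a - 1) * exp (- 1 / (2 * u\<^sup>2))) * indicator {0<..} u
      \<le> ennreal (exp ((a+1)\<^sup>2/2)) * (ennreal (\<bar>u\<bar> powr 0) * indicator {-1..1} u)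
          + ennreal (u powr (-a-1)) * indicator {1..} u"
    proof cases
      case 2
      have "u powr (- a - 1) * exp (- 1 / (2 * u\<^sup>2)) = (1/u) powr (a + 1) * exp (- (1/u)\<^sup>2 / 2)"
        using 2 powr_minus_divide[of u "a+1"] by (simp add: powr_divide power_divide)
      also have "\<dots> \<le> exp ((a+1)\<^sup>2/2)"
        using 2 assms by (intro powr_gaussian_bounded) auto
      finally show ?thesis using 2 by (simp add: add_increasing2)
    next
      case 3
      have "u powr (-a - 1) * exp (- 1 / (2 * u\<^sup>2)) \<le> u powr (-a - 1)" by (simp add: mult_left_le)
      then show ?thesis using 3 by simp
    qed auto
  qed
  also have "\<dots> < \<infinity>"
    using A B by (subst nn_integral_add; simp add: nn_integral_cmult ennreal_mult_less_top)
  finally show ?thesis .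
qed

text \<open>
  This writes a negative power \<open>r\<^bsup>-s\<^esup>\<close> of the frequency as a mixture of Gaussians in \<open>r\<close>.
\<close>

lemma gaussian_moment_scale:
  fixes s r :: real
  assumes "r > 0"
  shows "(\<integral>\<^sup>+u. ennreal (u powr (s - 1) * exp (- (u * r)\<^sup>2 / 2)) * indicator {0<..} u \<partial>lborel)
    = ennreal (r powr (- s)) * (\<integral>\<^sup>+u. ennreal (u powr (s - 1) * exp (- u\<^sup>2 / 2)) * indicator {0<..} u \<partial>lborel)"
proof -
  have eq: "ennreal ((u / r) powr (s - 1) * exp (- (u / r * r)\<^sup>2 / 2)) * indicator {0<..} (u / r)
     = ennreal (r powr (1 - s)) * (ennreal (u powr (s - 1) * exp (- u\<^sup>2 / 2)) * indicator {0<..} u)" for u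
    using assms
    by (auto simp: indicator_def powr_divide powr_diff field_simps simp flip: ennreal_mult)
  have "(\<integral>\<^sup>+u. ennreal (u powr (s - 1) * exp (- (u * r)\<^sup>2 / 2)) * indicator {0<..} u \<partial>lborel)
     = ennreal (1/r) * (\<integral>\<^sup>+u. ennreal ((u / r) powr (s - 1) * exp (- (u / r * r)\<^sup>2 / 2)) * indicator {0<..} (u / r) \<partial>lborel)"
    using assms by (subst nn_integral_real_affine[where c="1/r" and t=0]) auto
  also have "\<dots> = ennreal (1/r * r powr (1-s)) * (\<integral>\<^sup>+u. ennreal (u powr (s - 1) * exp (- u\<^sup>2 / 2)) * indicator {0<..} u \<partial>lborel)"
    unfolding eq ennreal_mult'[OF less_imp_le[OF divide_pos_pos[OF zero_less_one assms]]]
    by (subst nn_integral_cmult, measurable) (simp only: mult.assoc)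
  also have "1/r * r powr (1-s) = r powr (-s)"
    using assms by (simp add: powr_diff powr_minus field_simps)
  finally show ?thesis .
qed

text \<open>
  The counterpart in physical space: mixing heat kernels over their widths \<open>u\<close> produces a homogeneous
  kernel \<open>R\<^bsup>-a\<^esup>\<close>.
\<close>

lemma inverse_gaussian_moment_scale:
  fixes a R :: real
  assumes "R > 0"
  shows "(\<integral>\<^sup>+u. ennreal (u powr (- a - 1) * exp (- R\<^sup>2 / (2 * u\<^sup>2))) * indicator {0<..} u \<partial>lborel)
    = ennreal (R powr (- a)) * (\<integral>\<^sup>+u. ennreal (u powr (- a - 1) * exp (- 1 / (2 * u\<^sup>2))) * indicator {0<..} u \<partial>lborel)"
proof -
  have eq: "ennreal ((R * u) powr (- a - 1) * exp (- R\<^sup>2 / (2 * (R * u)\<^sup>2))) * indicator {0<..} (R * u)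
     = ennreal (R powr (- a - 1)) * (ennreal (u powr (- a - 1) * exp (- 1 / (2 * u\<^sup>2))) * indicator {0<..} u)" for u
  proof (cases "u > 0")
    case True
    then have "- R\<^sup>2 / (2 * (R * u)\<^sup>2) = - 1 / (2 * u\<^sup>2)"
      using assms by (simp add: power_mult_distrib)
    then show ?thesis
      using assms True by (simp add: powr_mult mult.assoc flip: ennreal_mult)
  qed (use assms in \<open>auto simp: zero_less_mult_iff\<close>)
  have "(\<integral>\<^sup>+u. ennreal (u powr (- a - 1) * exp (- R\<^sup>2 / (2 * u\<^sup>2))) * indicator {0<..} u \<partial>lborel)
     = ennreal R * (\<integral>\<^sup>+u. ennreal ((R * u) powr (- a - 1) * exp (- R\<^sup>2 / (2 * (R * u)\<^sup>2))) * indicator {0<..} (R * u) \<partial>lborel)"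
    using assms by (subst nn_integral_real_affine[where c=R and t=0]) auto
  also have "\<dots> = ennreal (R * R powr (-a-1)) * (\<integral>\<^sup>+u. ennreal (u powr (- a - 1) * exp (- 1 / (2 * u\<^sup>2))) * indicator {0<..} u \<partial>lborel)"
    unfolding eq using assms by (subst nn_integral_cmult; simp add: mult.assoc ennreal_mult)
  also have "R * R powr (-a-1) = R powr (-a)"
    using assms by (simp add: powr_diff powr_minus field_simps)
  finally show ?thesis .
qed

section \<open>Integration by coordinates and a weighted Hoelder inequality\<close>

lemma measurable_vec_nth_comp [measurable (raw)]:
  fixes f :: "'a \<Rightarrow> real ^ 'n::finite"
  assumes "f \<in> borel_measurable M"
  shows "(\<lambda>x. f x $ m) \<in> borel_measurable M"
proof (rule measurable_compose[OF assms])
  show "(\<lambda>x::real^'n. x $ m) \<in> borel_measurable borel"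
    by (intro borel_measurable_continuous_onI continuous_intros)
qed

lemma measurable_prod_coords:
  fixes F :: "'n::finite \<Rightarrow> real \<Rightarrow> 'b::{second_countable_topology, real_normed_field}"
  assumes "\<And>m. F m \<in> borel_measurable borel"
  shows "(\<lambda>x::real^'n. \<Prod>m\<in>I. F m (x $ m)) \<in> borel_measurable borel"
proof -
  have "(\<lambda>x::real^'n. F m (x $ m)) \<in> borel_measurable borel" for m
    using assms by measurable
  then show ?thesis by (intro borel_measurable_prod)
qed

lemma nn_integral_prod_coords:
  fixes F :: "'n::finite \<Rightarrow> real \<Rightarrow> real"
  assumes meas: "\<And>m. F m \<in> borel_measurable borel" and nonneg: "\<And>m u. F m u \<ge> 0"
  shows "(\<integral>\<^sup>+x. ennreal (\<Prod>m\<in>UNIV. F m (x $ m)) \<partial>(lborel :: (real^'n) measure))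
       = (\<Prod>m\<in>UNIV. (\<integral>\<^sup>+u. ennreal (F m u) \<partial>lborel))"
proof -
  define j :: "real^'n \<Rightarrow> 'n" where "j b = (SOME m. b = axis m 1)" for b
  have j: "j (axis m 1) = m" for m
    unfolding j_def by (rule some_equality) (auto simp: axis_eq_axis)
  have B: "(Basis :: (real^'n) set) = (\<lambda>m. axis m 1) ` UNIV"
    by (auto simp: Basis_vec_def)
  have inj: "inj (\<lambda>m::'n. axis m (1::real))" by (auto simp: inj_on_def axis_eq_axis)
  have "(\<integral>\<^sup>+x. (\<Prod>b\<in>Basis. ennreal (F (j b) (x \<bullet> b))) \<partial>(lborel :: (real^'n) measure))
      = (\<Prod>b\<in>(Basis :: (real^'n) set). (\<integral>\<^sup>+u. ennreal (F (j b) u) \<partial>lborel))"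
    using meas by (intro nn_integral_lborel_prod) auto
  then show ?thesis
    unfolding B using inj by (simp add: prod.reindex j inner_axis prod_ennreal nonneg)
qed

text \<open>
  Powers with negative exponent are only meaningful off the coordinate hyperplanes (in HOL, \<open>0 powr a = 0\<close>),
  so comparisons of weights are made outside these null sets.
\<close>

lemma AE_coord_nonzero:
  "AE x in (lborel :: (real^'n::finite) measure). \<forall>m. x $ m \<noteq> c m"
proof -
  have "AE x in (lborel :: (real^'n) measure). x $ m \<noteq> c m" for m
  proof -
    have "negligible {x::real^'n. axis m 1 \<bullet> x = c m}"
      by (rule negligible_hyperplane) simp
    then have "{x::real^'n. axis m 1 \<bullet> x = c m} \<in> null_sets lborel"
      by (auto simp: negligible_iff_null_sets null_sets_completion_iff)
    from AE_not_in[OF this] show ?thesis by (simp add: inner_axis')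
  qed
  then show ?thesis using AE_all_countable[of "\<lambda>m. \<lambda>x::real^'n. x $ m \<noteq> c m" lborel]
    by (simp add: AE_finite_all)
qed

text \<open>
  Hoelder's inequality for the splitting
  \<open>k h = (k w)\<^bsup>1 - 1/p\<^esup> (k w\<^bsup>1 - p\<^esup> h\<^sup>p)\<^bsup>1/p\<^esup>\<close>, which is the core of Schur's test. It is derived from
  Young's inequality with a free parameter \<open>s\<close>, optimised after integration; so the integral on the
  left may be infinite a priori.
\<close>

lemma nn_integral_Hoelder_weighted:
  fixes c W p :: real and k w h :: "'a \<Rightarrow> real"
  assumes p: "1 < p" and W: "0 < W" and c: "0 \<le> c"
    and [measurable]: "k \<in> borel_measurable M" "w \<in> borel_measurable M" "h \<in> borel_measurable M"
    and k: "\<And>y. 0 \<le> k y" and h: "\<And>y. 0 \<le> h y" and w: "\<And>y. 0 \<le> w y" "AE y in M. 0 < w y"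
    and kw: "(\<integral>\<^sup>+y. ennreal (k y * w y) \<partial>M) \<le> ennreal W"
    and kh: "ennreal c \<le> (\<integral>\<^sup>+y. ennreal (k y * h y) \<partial>M)"
  shows "ennreal (c powr p) \<le> ennreal (W powr (p - 1)) * (\<integral>\<^sup>+y. ennreal (k y * w y powr (1 - p) * h y powr p) \<partial>M)"
proof -
  define J where "J = (\<integral>\<^sup>+y. ennreal (k y * w y powr (1 - p) * h y powr p) \<partial>M)"
  have young: "c \<le> s powr (1 - p) / p * j + (1 - 1/p) * s * W" if s: "s > 0" and J: "J = ennreal j" "j \<ge> 0" for s j
  proof -
    have pt: "k y * h y \<le> s powr (1 - p) / p * (k y * w y powr (1 - p) * h y powr p) + (1 - 1/p) * s * (k y * w y)"
      if "0 < w y" for y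
    proof -
      define q where "q = p / (p - 1)"
      have q: "1 < q" "1/p + 1/q = 1" using p by (auto simp: q_def field_simps)
      define v where "v = h y / w y"
      have v: "0 \<le> v" using h w by (simp add: v_def)
      have a0: "0 \<le> v * s powr (-1/q)" "0 \<le> s powr (1/q)" using v by auto
      have "v = (v * s powr (-1/q)) * s powr (1/q)" using s by (simp add: powr_minus)
      also have "\<dots> \<le> (v * s powr (-1/q)) powr p / p + (s powr (1/q)) powr q / q"
        using Youngs_inequality[OF p q(1) q(2) a0] .
      also have "(v * s powr (-1/q)) powr p = v powr p * s powr (1 - p)"
        using p v by (simp add: powr_mult powr_powr q_def)
      also have "(s powr (1/q)) powr q / q = (1 - 1/p) * s"
      proof -
        have "1 - 1/p = 1/q" using q(2) by simp
        then show ?thesis using s q(1) by (simp only: powr_powr) simp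
      qed
      finally have le: "v \<le> v powr p * s powr (1 - p) / p + (1 - 1/p) * s" .
      have "k y * h y = k y * w y * v" using that by (simp add: v_def)
      also have "\<dots> \<le> k y * w y * (v powr p * s powr (1 - p) / p + (1 - 1/p) * s)"
        using le k w by (intro mult_left_mono) auto
      also have "w y * v powr p = w y powr (1 - p) * h y powr p"
        using that h by (simp add: v_def powr_divide powr_diff)
      then have "k y * w y * (v powr p * s powr (1 - p) / p + (1 - 1/p) * s)
         = s powr (1 - p) / p * (k y * w y powr (1 - p) * h y powr p) + (1 - 1/p) * s * (k y * w y)"
        by (simp add: distrib_left ac_simps)
      finally show ?thesis .
    qed
    have "ennreal c \<le> (\<integral>\<^sup>+y. ennreal (k y * h y) \<partial>M)" by (rule kh)
    also have "\<dots> \<le> (\<integral>\<^sup>+y. ennreal (s powr (1 - p) / p) * ennreal (k y * w y powr (1 - p) * h y powr p)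
         + ennreal ((1 - 1/p) * s) * ennreal (k y * w y) \<partial>M)"
      using w(2)
    proof (intro nn_integral_mono_AE, eventually_elim)
      fix y assume "0 < w y"
      from pt[OF this] show "ennreal (k y * h y) \<le> ennreal (s powr (1 - p) / p) * ennreal (k y * w y powr (1 - p) * h y powr p)
         + ennreal ((1 - 1/p) * s) * ennreal (k y * w y)"
        using p s k w by (simp flip: ennreal_mult ennreal_plus)
    qed
    also have "\<dots> = ennreal (s powr (1 - p) / p) * J + ennreal ((1 - 1/p) * s) * (\<integral>\<^sup>+y. ennreal (k y * w y) \<partial>M)"
      unfolding J_def by (simp add: nn_integral_add nn_integral_cmult)
    also have "\<dots> \<le> ennreal (s powr (1 - p) / p) * ennreal j + ennreal ((1 - 1/p) * s) * ennreal W"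
      unfolding J by (intro add_left_mono mult_left_mono kw) auto
    also have "\<dots> = ennreal (s powr (1 - p) / p * j + (1 - 1/p) * s * W)"
      using p s W J by (simp flip: ennreal_mult ennreal_plus)
    finally show ?thesis using p s W J by (subst (asm) ennreal_le_iff) auto
  qed
  show ?thesis
  proof (cases "J = \<infinity>")
    case True
    then show ?thesis using W by (simp add: J_def[symmetric] ennreal_mult_top)
  next
    case False
    then obtain j where j: "J = ennreal j" "j \<ge> 0" by (cases J) auto
    have "c powr p \<le> W powr (p - 1) * j"
    proof (cases "j = 0")
      case True
      have "c \<le> 0"
      proof (rule field_le_epsilon)
        fix e :: real assume e: "e > 0"
        have "c \<le> (1 - 1/p) * (e / W) * W" using young[OF _ j, of "e / W"] True e W by simp
        also have "\<dots> = (1 - 1/p) * e" using W by simp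
        also have "\<dots> \<le> 0 + e" using p e by (simp add: field_simps)
        finally show "c \<le> 0 + e" .
      qed
      then show ?thesis using c j by simp
    next
      case False
      then have j0: "j > 0" using j by simp
      \<comment> \<open>The minimiser of the right-hand side of \<open>young\<close>.\<close>
      define s where "s = (j / W) powr (1/p)"
      have s: "s > 0" using j0 W by (simp add: s_def)
      have sp: "s powr p = j / W" using j0 W p by (simp add: s_def powr_powr)
      have "s powr (1 - p) * j = s * W"
        using s sp j0 W by (simp add: powr_diff field_simps)
      then have "s powr (1 - p) / p * j + (1 - 1/p) * s * W = s * W"
        using p by (simp add: field_simps)
      then have "c \<le> s * W" using young[OF s j] by simp
      then have "c powr p \<le> (s * W) powr p" using c p by (intro powr_mono2) auto
      also have "\<dots> = j / W * W powr p" using s W by (simp add: powr_mult sp)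
      also have "\<dots> = W powr (p - 1) * j" using W by (simp add: powr_diff)
      finally show ?thesis .
    qed
    then show ?thesis using j W by (simp add: J_def[symmetric] ennreal_leI flip: ennreal_mult)
  qed
qed

section \<open>A weighted bound for product kernels\<close>

definition coord_proj :: "'n::finite set \<Rightarrow> real ^ 'n \<Rightarrow> real ^ 'n" where
  "coord_proj B x = (\<chi> m. if m \<in> B then x $ m else 0)"

text \<open>
  The product of one-dimensional Riesz kernels in the variables of \<open>B\<close> and of Gaussian probability
  densities in the others; the latter turn a partial convolution into an integral over the whole space.
\<close>

definition riesz_gauss_kernel :: "'n::finite set \<Rightarrow> ('n \<Rightarrow> real) \<Rightarrow> real ^ 'n \<Rightarrow> real" where
  "riesz_gauss_kernel B \<gamma> y =
     (\<Prod>m\<in>UNIV. if m \<in> B then \<bar>y $ m\<bar> powr (\<gamma> m - 1) else std_normal_density (y $ m))"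

lemma coord_proj_nth [simp]: "coord_proj B x $ m = (if m \<in> B then x $ m else 0)"
  by (simp add: coord_proj_def)

lemma measurable_coord_proj [measurable]:
  fixes B :: "'n::finite set"
  shows "coord_proj B \<in> borel_measurable borel"
proof (rule borel_measurable_continuous_onI)
  have "continuous_on UNIV (\<lambda>x::real^'n. if m \<in> B then x $ m else 0)" for m
    by (cases "m \<in> B") (auto intro!: continuous_intros)
  then show "continuous_on UNIV (coord_proj B)"
    unfolding coord_proj_def[abs_def] by (intro continuous_on_vec_lambda)
qed

lemma riesz_gauss_kernel_nonneg [simp]: "0 \<le> riesz_gauss_kernel B \<gamma> y"
  by (auto simp: riesz_gauss_kernel_def intro!: prod_nonneg)

lemma measurable_riesz_gauss_kernel [measurable]: "riesz_gauss_kernel B \<gamma> \<in> borel_measurable borel"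
proof -
  have "(\<lambda>u. if m \<in> B then \<bar>u\<bar> powr (\<gamma> m - 1) else std_normal_density u) \<in> borel_measurable borel" for m
    by measurable
  from measurable_prod_coords[of "\<lambda>m u. if m \<in> B then \<bar>u\<bar> powr (\<gamma> m - 1) else std_normal_density u", OF this]
  show ?thesis unfolding riesz_gauss_kernel_def[abs_def] .
qed

lemma nn_integral_translate:
  fixes F :: "'a::euclidean_space \<Rightarrow> ennreal"
  assumes [measurable]: "F \<in> borel_measurable borel"
  shows "(\<integral>\<^sup>+x. F (x + t) \<partial>lborel) = (\<integral>\<^sup>+x. F x \<partial>lborel)"
proof -
  have "(\<integral>\<^sup>+x. F x \<partial>lborel) = (\<integral>\<^sup>+x. F x \<partial>distr lborel borel ((+) t))"
    by (simp add: lborel_distr_plus)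
  also have "\<dots> = (\<integral>\<^sup>+x. F (t + x) \<partial>lborel)" by (subst nn_integral_distr) auto
  finally show ?thesis by (simp add: add.commute)
qed

text \<open>
  The integral factors over the coordinates: each coordinate in \<open>B\<close> contributes a one-dimensional
  convolution of powers, each of the others the factor \<open>1\<close>.
\<close>

lemma riesz_gauss_kernel_weight:
  fixes B :: "'n::finite set" and \<gamma> b :: "'n \<Rightarrow> real"
  assumes "\<And>m. m \<in> B \<Longrightarrow> 0 < \<gamma> m \<and> \<gamma> m < b m \<and> b m < 1"
  shows "\<exists>C>0. \<forall>x. (\<forall>m. x $ m \<noteq> 0) \<longrightarrow>
      (\<integral>\<^sup>+y. ennreal (riesz_gauss_kernel B \<gamma> y * (\<Prod>m\<in>B. \<bar>x $ m - y $ m\<bar> powr (- b m))) \<partial>lborel)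
        \<le> ennreal (C * (\<Prod>m\<in>B. \<bar>x $ m\<bar> powr (\<gamma> m - b m)))"
proof -
  define Q where "Q m C \<longleftrightarrow> 0 < C \<and> (\<forall>x. x \<noteq> 0 \<longrightarrow>
        (\<integral>\<^sup>+u. ennreal (\<bar>u\<bar> powr (\<gamma> m - 1) * \<bar>x - u\<bar> powr (- b m)) \<partial>lborel)
        \<le> ennreal (C * \<bar>x\<bar> powr (\<gamma> m - b m)))" for m C
  have "\<exists>C. Q m C" if m: "m \<in> B" for m
  proof -
    have "0 < \<gamma> m" "\<gamma> m < b m" "b m < 1" using assms[OF m] by auto
    then show ?thesis by (rule nn_integral_powr_convolution) (auto simp: Q_def)
  qed
  then obtain c where Q: "\<And>m. m \<in> B \<Longrightarrow> Q m (c m)" by metis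
  have c: "\<And>m. m \<in> B \<Longrightarrow> 0 < c m" "\<And>m x. m \<in> B \<Longrightarrow> x \<noteq> 0 \<Longrightarrow>
        (\<integral>\<^sup>+u. ennreal (\<bar>u\<bar> powr (\<gamma> m - 1) * \<bar>x - u\<bar> powr (- b m)) \<partial>lborel)
        \<le> ennreal (c m * \<bar>x\<bar> powr (\<gamma> m - b m))"
    using Q by (auto simp: Q_def)
  have split: "(\<Prod>m\<in>UNIV. if m \<in> B then F m else 1) = (\<Prod>m\<in>B. F m)" for F :: "'n \<Rightarrow> real"
    by (simp add: prod.If_cases)
  show ?thesis
  proof (intro exI[of _ "\<Prod>m\<in>B. c m"] conjI allI impI)
    show "(\<Prod>m\<in>B. c m) > 0" using c by (intro prod_pos) auto
    fix x :: "real^'n" assume x: "\<forall>m. x $ m \<noteq> 0"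
    define F where "F m u = (if m \<in> B then \<bar>u\<bar> powr (\<gamma> m - 1) * \<bar>x $ m - u\<bar> powr (- b m) else std_normal_density u)"
      for m u
    have F: "riesz_gauss_kernel B \<gamma> y * (\<Prod>m\<in>B. \<bar>x $ m - y $ m\<bar> powr (- b m)) = (\<Prod>m\<in>UNIV. F m (y $ m))" for y
      unfolding riesz_gauss_kernel_def F_def
      by (subst split[symmetric], subst prod.distrib[symmetric]) (auto intro!: prod.cong)
    have "(\<integral>\<^sup>+y. ennreal (riesz_gauss_kernel B \<gamma> y * (\<Prod>m\<in>B. \<bar>x $ m - y $ m\<bar> powr (- b m))) \<partial>lborel)
      = (\<Prod>m\<in>UNIV. (\<integral>\<^sup>+u. ennreal (F m u) \<partial>lborel))"
      unfolding F by (intro nn_integral_prod_coords) (auto simp: F_def)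
    also have "\<dots> \<le> (\<Prod>m\<in>UNIV. ennreal (if m \<in> B then c m * \<bar>x $ m\<bar> powr (\<gamma> m - b m) else 1))"
    proof (rule prod_mono_ennreal)
      fix m
      show "(\<integral>\<^sup>+u. ennreal (F m u) \<partial>lborel) \<le> ennreal (if m \<in> B then c m * \<bar>x $ m\<bar> powr (\<gamma> m - b m) else 1)"
        using c(2)[of m "x $ m"] x by (auto simp: F_def nn_integral_eq_integral)
    qed
    also have "\<dots> = ennreal (\<Prod>m\<in>UNIV. if m \<in> B then c m * \<bar>x $ m\<bar> powr (\<gamma> m - b m) else 1)"
      using c(1) by (intro prod_ennreal) (auto simp: less_imp_le)
    also have "\<dots> = ennreal ((\<Prod>m\<in>B. c m) * (\<Prod>m\<in>B. \<bar>x $ m\<bar> powr (\<gamma> m - b m)))"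
      by (simp add: split prod.distrib)
    finally show "(\<integral>\<^sup>+y. ennreal (riesz_gauss_kernel B \<gamma> y * (\<Prod>m\<in>B. \<bar>x $ m - y $ m\<bar> powr (- b m))) \<partial>lborel)
      \<le> ennreal ((\<Prod>m\<in>B. c m) * (\<Prod>m\<in>B. \<bar>x $ m\<bar> powr (\<gamma> m - b m)))" .
  qed
qed

lemma prod_powr_nonneg [simp]: "0 \<le> (\<Prod>m\<in>B. (f m :: real) powr g m)"
  by (intro prod_nonneg) auto

lemma prod_powr_distrib_const:
  fixes f g :: "'i \<Rightarrow> real"
  shows "(\<Prod>m\<in>B. f m powr g m) powr a = (\<Prod>m\<in>B. f m powr (g m * a))"
  by (simp add: prod_powr_distrib powr_powr)

text \<open>
  Schur's test with the weight \<open>w = \<Prod>\<^sub>m |x\<^sub>m|\<^bsup>-1/p\<^esup>\<close>. Write \<open>v\<close> for \<open>\<Prod>\<^sub>m |x\<^sub>m|\<^bsup>-\<gamma>\<^sub>m\<^esup>\<close>. Convolving \<open>w\<close>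
  with the kernel gives a multiple of \<open>w / v\<close>, so Hoelder's inequality bounds the \<open>p\<close>-th power of
  \<open>v u\<close> by a double integral of \<open>h\<^sup>p\<close>. After exchanging the integrals and translating \<open>x\<close>, the
  kernel is integrated against \<open>\<Prod>\<^sub>m |x\<^sub>m + y\<^sub>m|\<^bsup>-(\<gamma>\<^sub>m + e)\<^esup>\<close> with \<open>e = 1 - 1/p\<close>. The result
  \<open>\<Prod>\<^sub>m |x\<^sub>m|\<^bsup>-e\<^esup>\<close> cancels the remaining factor exactly. The conditions \<open>\<gamma>\<^sub>m < 1/p < 1\<close> and
  \<open>\<gamma>\<^sub>m + e < 1\<close> for convergence both hold because \<open>\<gamma>\<^sub>m < 1/p\<close> and \<open>p > 1\<close>.
\<close>

lemma weighted_riesz_gauss_bound: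
  fixes B :: "'n::finite set" and \<gamma> :: "'n \<Rightarrow> real" and p :: real
  assumes p: "1 < p" and \<gamma>: "\<And>m. m \<in> B \<Longrightarrow> 0 < \<gamma> m \<and> \<gamma> m < 1 / p"
  obtains C :: real where "C > 0"
    "\<And>h u. h \<in> borel_measurable borel \<Longrightarrow> (\<And>x. 0 \<le> h x) \<Longrightarrow> (\<And>x. 0 \<le> u x) \<Longrightarrow>
       (AE x in lborel. ennreal (u x) \<le> (\<integral>\<^sup>+y. ennreal (riesz_gauss_kernel B \<gamma> y * h (x - coord_proj B y)) \<partial>lborel)) \<Longrightarrow>
       (\<integral>\<^sup>+x. ennreal (((\<Prod>m\<in>B. \<bar>x $ m\<bar> powr (- \<gamma> m)) * u x) powr p) \<partial>lborel)
         \<le> ennreal C * (\<integral>\<^sup>+x. ennreal (h x powr p) \<partial>lborel)"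
proof -
  let ?k = "riesz_gauss_kernel B \<gamma>"
  define e where "e = 1 - 1 / p"
  have e: "0 < e" "e < 1" using p by (auto simp: e_def)
  have "0 < \<gamma> m \<and> \<gamma> m < 1/p \<and> 1/p < 1" if "m \<in> B" for m
    using \<gamma>[OF that] p by simp
  then obtain C1 :: real where C1: "C1 > 0" "\<And>x. \<forall>m. x $ m \<noteq> 0 \<Longrightarrow>
      (\<integral>\<^sup>+y. ennreal (?k y * (\<Prod>m\<in>B. \<bar>x $ m - y $ m\<bar> powr (- (1/p)))) \<partial>lborel)
        \<le> ennreal (C1 * (\<Prod>m\<in>B. \<bar>x $ m\<bar> powr (\<gamma> m - 1/p)))"
    using riesz_gauss_kernel_weight[where b="\<lambda>_. 1/p" and B=B and \<gamma>=\<gamma>] by blast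
  have "0 < \<gamma> m \<and> \<gamma> m < \<gamma> m + e \<and> \<gamma> m + e < 1" if "m \<in> B" for m
    using \<gamma>[OF that] e by (simp add: e_def)
  then obtain C2 :: real where C2: "C2 > 0" "\<And>x. \<forall>m. x $ m \<noteq> 0 \<Longrightarrow>
      (\<integral>\<^sup>+y. ennreal (?k y * (\<Prod>m\<in>B. \<bar>x $ m - y $ m\<bar> powr (- (\<gamma> m + e)))) \<partial>lborel)
        \<le> ennreal (C2 * (\<Prod>m\<in>B. \<bar>x $ m\<bar> powr (\<gamma> m - (\<gamma> m + e))))"
    using riesz_gauss_kernel_weight[where b="\<lambda>m. \<gamma> m + e" and B=B and \<gamma>=\<gamma>] by blast
  show ?thesis
  proof (rule that[of "C1 powr (p - 1) * C2"])
    show "C1 powr (p - 1) * C2 > 0" using C1 C2 by simp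
    fix h u :: "real^'n \<Rightarrow> real"
    assume [measurable]: "h \<in> borel_measurable borel" and h: "\<And>x. 0 \<le> h x" and u: "\<And>x. 0 \<le> u x"
      and uh: "AE x in lborel. ennreal (u x) \<le> (\<integral>\<^sup>+y. ennreal (?k y * h (x - coord_proj B y)) \<partial>lborel)"
    \<comment> \<open>The integrand after the translation \<open>z = x - coord_proj B y\<close>.\<close>
    define K where "K z y = (\<Prod>m\<in>B. \<bar>z $ m + y $ m\<bar> powr (- (\<gamma> m + e))) * ?k y * (\<Prod>m\<in>B. \<bar>z $ m\<bar> powr e) * h z powr p"
      for z y :: "real^'n"
    have K0: "0 \<le> K z y" for z y unfolding K_def by (intro mult_nonneg_nonneg) auto
    have [measurable]: "(\<lambda>(z, y). K z y) \<in> borel_measurable (borel \<Otimes>\<^sub>M borel)"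
      unfolding K_def by measurable
    have pointwise: "ennreal (((\<Prod>m\<in>B. \<bar>x $ m\<bar> powr (- \<gamma> m)) * u x) powr p)
        \<le> ennreal (C1 powr (p - 1)) * (\<integral>\<^sup>+y. ennreal (K (x - coord_proj B y) y) \<partial>lborel)"
      if x: "\<forall>m. x $ m \<noteq> 0"
        and ux: "ennreal (u x) \<le> (\<integral>\<^sup>+y. ennreal (?k y * h (x - coord_proj B y)) \<partial>lborel)" for x
    proof -
      define W where "W = C1 * (\<Prod>m\<in>B. \<bar>x $ m\<bar> powr (\<gamma> m - 1/p))"
      define w where "w y = (\<Prod>m\<in>B. \<bar>x $ m - y $ m\<bar> powr (- (1/p)))" for y :: "real^'n"
      have W: "W > 0" using C1 x by (auto simp: W_def intro!: mult_pos_pos prod_pos)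
      have [measurable]: "w \<in> borel_measurable borel" unfolding w_def by measurable
      have "AE y in (lborel :: (real^'n) measure). 0 < w y"
        using AE_coord_nonzero[of "\<lambda>m. x $ m"]
        by eventually_elim (auto simp: w_def intro!: prod_pos, metis)
      moreover have "0 \<le> w y" for y by (simp add: w_def)
      ultimately have H: "ennreal (u x powr p) \<le> ennreal (W powr (p - 1)) *
          (\<integral>\<^sup>+y. ennreal (?k y * w y powr (1 - p) * h (x - coord_proj B y) powr p) \<partial>lborel)"
        using C1(2)[OF x] ux h
        by (intro nn_integral_Hoelder_weighted p W u) (auto simp: W_def w_def)
      define X where "X = (\<Prod>m\<in>B. \<bar>x $ m\<bar> powr (- (\<gamma> m + e)))"
      have coeff: "(\<Prod>m\<in>B. \<bar>x $ m\<bar> powr (- \<gamma> m)) powr p * W powr (p - 1) = C1 powr (p - 1) * X"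
      proof -
        have ex: "- \<gamma> m * p + (\<gamma> m - 1/p) * (p - 1) = - (\<gamma> m + e)" for m
          using p by (simp add: e_def field_simps)
        have "(\<Prod>m\<in>B. \<bar>x $ m\<bar> powr (- \<gamma> m)) powr p * W powr (p - 1)
           = C1 powr (p - 1) * ((\<Prod>m\<in>B. \<bar>x $ m\<bar> powr (- \<gamma> m * p)) * (\<Prod>m\<in>B. \<bar>x $ m\<bar> powr ((\<gamma> m - 1/p) * (p - 1))))"
          using C1 by (simp add: W_def powr_mult prod_powr_distrib_const)
        also have "(\<Prod>m\<in>B. \<bar>x $ m\<bar> powr (- \<gamma> m * p)) * (\<Prod>m\<in>B. \<bar>x $ m\<bar> powr ((\<gamma> m - 1/p) * (p - 1))) = X"
          unfolding X_def prod.distrib[symmetric] powr_add[symmetric] ex ..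
        finally show ?thesis .
      qed
      have Keq: "K (x - coord_proj B y) y = X * (?k y * w y powr (1 - p) * h (x - coord_proj B y) powr p)" for y
      proof -
        have "w y powr (1 - p) = (\<Prod>m\<in>B. \<bar>x $ m - y $ m\<bar> powr e)"
        proof -
          have "- (1/p) * (1 - p) = e" using p by (simp add: e_def field_simps)
          then show ?thesis by (simp only: w_def prod_powr_distrib_const)
        qed
        moreover have "(\<Prod>m\<in>B. \<bar>(x - coord_proj B y) $ m\<bar> powr e) = (\<Prod>m\<in>B. \<bar>x $ m - y $ m\<bar> powr e)"
          by (intro prod.cong) auto
        moreover have "(\<Prod>m\<in>B. \<bar>(x - coord_proj B y) $ m + y $ m\<bar> powr (- (\<gamma> m + e))) = X"
          unfolding X_def by (intro prod.cong) auto
        ultimately show ?thesis by (simp add: K_def ac_simps)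
      qed
      have X0: "0 \<le> X" by (simp add: X_def)
      have "ennreal (((\<Prod>m\<in>B. \<bar>x $ m\<bar> powr (- \<gamma> m)) * u x) powr p)
         = ennreal ((\<Prod>m\<in>B. \<bar>x $ m\<bar> powr (- \<gamma> m)) powr p) * ennreal (u x powr p)"
        using u by (simp add: powr_mult ennreal_mult)
      also have "\<dots> \<le> ennreal ((\<Prod>m\<in>B. \<bar>x $ m\<bar> powr (- \<gamma> m)) powr p) * (ennreal (W powr (p - 1)) *
          (\<integral>\<^sup>+y. ennreal (?k y * w y powr (1 - p) * h (x - coord_proj B y) powr p) \<partial>lborel))"
        by (intro mult_left_mono H) auto
      also have "\<dots> = ennreal ((\<Prod>m\<in>B. \<bar>x $ m\<bar> powr (- \<gamma> m)) powr p * W powr (p - 1)) *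
          (\<integral>\<^sup>+y. ennreal (?k y * w y powr (1 - p) * h (x - coord_proj B y) powr p) \<partial>lborel)"
        by (simp add: ennreal_mult mult.assoc)
      also have "\<dots> = ennreal (C1 powr (p - 1)) * (ennreal X *
          (\<integral>\<^sup>+y. ennreal (?k y * w y powr (1 - p) * h (x - coord_proj B y) powr p) \<partial>lborel))"
        unfolding coeff using X0 by (simp add: ennreal_mult mult.assoc)
      also have "ennreal X * (\<integral>\<^sup>+y. ennreal (?k y * w y powr (1 - p) * h (x - coord_proj B y) powr p) \<partial>lborel)
         = (\<integral>\<^sup>+y. ennreal (K (x - coord_proj B y) y) \<partial>lborel)"
        unfolding Keq using X0 by (subst nn_integral_cmult[symmetric]) (auto simp: ennreal_mult)
      finally show ?thesis .
    qed
    have inner: "(\<integral>\<^sup>+y. ennreal (K z y) \<partial>lborel) \<le> ennreal C2 * ennreal (h z powr p)"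
      if z: "\<forall>m. z $ m \<noteq> 0" for z
    proof -
      define Z where "Z = (\<Prod>m\<in>B. \<bar>z $ m\<bar> powr e) * h z powr p"
      have Z0: "0 \<le> Z" by (simp add: Z_def)
      have neg: "\<bar>(- z) $ m - y $ m\<bar> = \<bar>z $ m + y $ m\<bar>" for m and y :: "real^'n"
        by simp
      have "(\<integral>\<^sup>+y. ennreal (K z y) \<partial>lborel)
         = (\<integral>\<^sup>+y. ennreal Z * ennreal (?k y * (\<Prod>m\<in>B. \<bar>(- z) $ m - y $ m\<bar> powr (- (\<gamma> m + e)))) \<partial>lborel)"
        unfolding neg using Z0 by (intro nn_integral_cong) (auto simp: K_def Z_def ac_simps simp flip: ennreal_mult)
      also have "\<dots> = ennreal Z * (\<integral>\<^sup>+y. ennreal (?k y * (\<Prod>m\<in>B. \<bar>(- z) $ m - y $ m\<bar> powr (- (\<gamma> m + e)))) \<partial>lborel)"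
        by (intro nn_integral_cmult) measurable
      also have "\<dots> \<le> ennreal Z * ennreal (C2 * (\<Prod>m\<in>B. \<bar>(- z) $ m\<bar> powr (\<gamma> m - (\<gamma> m + e))))"
        using z by (intro mult_left_mono C2) auto
      also have "\<dots> = ennreal (C2 * h z powr p * (\<Prod>m\<in>B. \<bar>z $ m\<bar> powr e * \<bar>z $ m\<bar> powr (- e)))"
        using C2 Z0 by (simp add: Z_def prod.distrib ac_simps flip: ennreal_mult)
      also have "(\<Prod>m\<in>B. \<bar>z $ m\<bar> powr e * \<bar>z $ m\<bar> powr (- e)) = 1"
        using z by (intro prod.neutral) (auto simp flip: powr_add)
      finally show ?thesis using C2 by (simp add: ennreal_mult)
    qed
    have translate: "(\<integral>\<^sup>+x. ennreal (K (x - coord_proj B y) y) \<partial>lborel) = (\<integral>\<^sup>+x. ennreal (K x y) \<partial>lborel)" for y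
      using nn_integral_translate[of "\<lambda>x. ennreal (K x y)" "- coord_proj B y"] by simp
    have "(\<integral>\<^sup>+x. ennreal (((\<Prod>m\<in>B. \<bar>x $ m\<bar> powr (- \<gamma> m)) * u x) powr p) \<partial>lborel)
       \<le> (\<integral>\<^sup>+x. ennreal (C1 powr (p - 1)) * (\<integral>\<^sup>+y. ennreal (K (x - coord_proj B y) y) \<partial>lborel) \<partial>lborel)"
      using uh AE_coord_nonzero[of "\<lambda>_. 0"]
      by (intro nn_integral_mono_AE, eventually_elim) (rule pointwise, auto)
    also have "\<dots> = ennreal (C1 powr (p - 1)) * (\<integral>\<^sup>+x. \<integral>\<^sup>+y. ennreal (K (x - coord_proj B y) y) \<partial>lborel \<partial>lborel)"
      by (intro nn_integral_cmult) measurable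
    also have "(\<integral>\<^sup>+x. \<integral>\<^sup>+y. ennreal (K (x - coord_proj B y) y) \<partial>lborel \<partial>lborel)
       = (\<integral>\<^sup>+y. \<integral>\<^sup>+x. ennreal (K (x - coord_proj B y) y) \<partial>lborel \<partial>lborel)"
      by (intro lborel_pair.Fubini'[symmetric]) measurable
    also have "\<dots> = (\<integral>\<^sup>+y. \<integral>\<^sup>+x. ennreal (K x y) \<partial>lborel \<partial>lborel)"
      by (simp only: translate)
    also have "\<dots> = (\<integral>\<^sup>+x. \<integral>\<^sup>+y. ennreal (K x y) \<partial>lborel \<partial>lborel)"
      by (intro lborel_pair.Fubini') measurable
    also have "\<dots> \<le> (\<integral>\<^sup>+x. ennreal C2 * ennreal (h x powr p) \<partial>lborel)"
      using AE_coord_nonzero[of "\<lambda>_. 0"]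
      by (intro nn_integral_mono_AE, eventually_elim) (rule inner, auto)
    also have "\<dots> = ennreal C2 * (\<integral>\<^sup>+x. ennreal (h x powr p) \<partial>lborel)"
      by (intro nn_integral_cmult) measurable
    finally show "(\<integral>\<^sup>+x. ennreal (((\<Prod>m\<in>B. \<bar>x $ m\<bar> powr (- \<gamma> m)) * u x) powr p) \<partial>lborel)
         \<le> ennreal (C1 powr (p - 1) * C2) * (\<integral>\<^sup>+x. ennreal (h x powr p) \<partial>lborel)"
      using C1 C2 by (simp add: mult_left_mono ennreal_mult mult.assoc)
  qed
qed

section \<open>Decay of the Fourier transform of a test function\<close>

lemma test_function_continuous:
  assumes "test_function f" shows "continuous_on UNIV f"
proof -
  have "times_cont_diff 0 f" using assms unfolding test_function_def by blast
  then show ?thesis by simp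
qed

lemma test_function_measurable [measurable_dest]:
  assumes "test_function f" shows "f \<in> borel_measurable borel"
  by (rule borel_measurable_continuous_onI[OF test_function_continuous[OF assms]])

lemma test_function_has_derivative:
  assumes "test_function f"
  shows "(f has_derivative frechet_derivative f (at x)) (at x)"
proof -
  have "times_cont_diff (Suc 0) f" using assms unfolding test_function_def by blast
  then show ?thesis by (simp add: frechet_derivative_works)
qed

lemma test_function_support:
  assumes "test_function f"
  obtains R where "R > 0" "\<And>x. f x \<noteq> 0 \<Longrightarrow> norm x \<le> R"
proof -
  have "bounded (closure (support_on UNIV f))"
    using assms unfolding test_function_def by (intro compact_imp_bounded) auto
  then obtain R where R: "R > 0" "\<And>x. x \<in> closure (support_on UNIV f) \<Longrightarrow> norm x \<le> R"
    by (auto simp: bounded_pos)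
  show ?thesis
  proof (rule that[OF R(1)])
    fix x assume "f x \<noteq> 0"
    then have "x \<in> support_on UNIV f" by (simp add: support_on_def)
    then show "norm x \<le> R" using R(2) closure_subset by blast
  qed
qed

lemma test_function_bounded:
  assumes "test_function f"
  obtains M where "M \<ge> 0" "\<And>x. norm (f x) \<le> M"
proof -
  obtain R where R: "R > 0" "\<And>x. f x \<noteq> 0 \<Longrightarrow> norm x \<le> R" using test_function_support[OF assms] by blast
  have "compact (f ` cball 0 R)"
    using test_function_continuous[OF assms] by (intro compact_continuous_image) (auto intro: continuous_on_subset)
  then obtain M where M: "M > 0" "\<And>y. y \<in> f ` cball 0 R \<Longrightarrow> norm y \<le> M"
    using compact_imp_bounded bounded_pos by metis
  show ?thesis
  proof (rule that[of M])
    fix x show "norm (f x) \<le> M"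
      using R(2)[of x] M by (cases "f x = 0") auto
  qed (use M in simp)
qed

lemma test_function_integrable:
  assumes "test_function f" shows "integrable lborel f"
proof -
  obtain R where R: "R > 0" "\<And>x. f x \<noteq> 0 \<Longrightarrow> norm x \<le> R" using test_function_support[OF assms] by blast
  have "integrable lborel (\<lambda>x. indicator (cball 0 R) x *\<^sub>R f x)"
    using test_function_continuous[OF assms] by (intro borel_integrable_compact) (auto intro: continuous_on_subset)
  moreover have "(\<lambda>x. indicator (cball 0 R) x *\<^sub>R f x) = f"
    using R(2) by (auto simp: indicator_def fun_eq_iff)
  ultimately show ?thesis by simp
qed

lemma test_function_deriv:
  assumes "test_function f"
  shows "test_function (\<lambda>x. frechet_derivative f (at x) v)"
  unfolding test_function_def
proof (intro conjI allI)
  fix k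
  have "times_cont_diff (Suc k) f" using assms unfolding test_function_def by blast
  then show "times_cont_diff k (\<lambda>x. frechet_derivative f (at x) v)" by simp
next
  let ?K = "closure (support_on UNIV f)"
  have "support_on UNIV (\<lambda>x. frechet_derivative f (at x) v) \<subseteq> ?K"
  proof
    fix x assume x: "x \<in> support_on UNIV (\<lambda>x. frechet_derivative f (at x) v)"
    show "x \<in> ?K"
    proof (rule ccontr)
      assume "x \<notin> ?K"
      have zero: "0 = f y" if "y \<in> - ?K" for y
      proof (rule ccontr)
        assume "0 \<noteq> f y"
        then have "y \<in> support_on UNIV f" by (simp add: support_on_def)
        then show False using that closure_subset by blast
      qed
      have "open (- ?K)" "x \<in> - ?K" using \<open>x \<notin> ?K\<close> by auto
      then have "(f has_derivative (\<lambda>_. 0)) (at x)"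
        using zero by (rule has_derivative_transform_within_open[OF has_derivative_const])
      then have "frechet_derivative f (at x) = (\<lambda>_. 0)" by (rule frechet_derivative_at[symmetric])
      then show False using x by (simp add: support_on_def)
    qed
  qed
  then have "closure (support_on UNIV (\<lambda>x. frechet_derivative f (at x) v)) \<subseteq> ?K"
    by (intro closure_minimal) auto
  moreover have "compact ?K" using assms unfolding test_function_def by blast
  ultimately show "compact (closure (support_on UNIV (\<lambda>x. frechet_derivative f (at x) v)))"
    by (meson closed_closure compact_Int_closed compact_closure bounded_subset compact_imp_bounded closure_subset bounded_closure)
qed

lemma norm_exp_i [simp]: "norm (exp (\<i> * complex_of_real r)) = 1"
  "norm (exp (- (\<i> * complex_of_real r))) = 1"
  using norm_exp_i_times[of r] norm_exp_i_times[of "- r"] by simp_all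

lemma integrable_mult_unimodular:
  fixes f g :: "'a \<Rightarrow> complex"
  assumes "integrable M f" "g \<in> borel_measurable M" "\<And>x. norm (g x) \<le> 1"
  shows "integrable M (\<lambda>x. f x * g x)"
proof (rule Bochner_Integration.integrable_bound[OF assms(1)])
  show "(\<lambda>x. f x * g x) \<in> borel_measurable M"
    using assms borel_measurable_integrable by (intro borel_measurable_times) auto
  show "AE x in M. norm (f x * g x) \<le> norm (f x)"
    using assms(3) by (auto simp: norm_mult mult_left_le)
qed

lemma norm_fourier_le:
  fixes f :: "real ^ 'n::finite \<Rightarrow> complex"
  shows "norm (fourier f \<xi>) \<le> (2 * pi) powr (- real CARD('n) / 2) * (LINT x|lborel. norm (f x))"
proof -
  have "norm (LINT x|lborel. f x * exp (- \<i> * complex_of_real (\<xi> \<bullet> x)))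
      \<le> (LINT x|lborel. norm (f x * exp (- \<i> * complex_of_real (\<xi> \<bullet> x))))"
    by (rule integral_norm_bound)
  also have "\<dots> = (LINT x|lborel. norm (f x))" by (simp add: norm_mult)
  finally show ?thesis by (simp add: fourier_def norm_mult mult_left_mono)
qed

lemma measurable_fourier [measurable]:
  assumes [measurable]: "f \<in> borel_measurable borel"
  shows "fourier f \<in> borel_measurable borel"
  unfolding fourier_def[abs_def] by measurable

lemma measurable_inverse_fourier [measurable]:
  assumes [measurable]: "f \<in> borel_measurable borel"
  shows "inverse_fourier f \<in> borel_measurable borel"
  unfolding inverse_fourier_def[abs_def] by measurable

lemma directional_difference_quotient_limit:
  fixes g :: "real \<Rightarrow> 'b::real_normed_vector"
  assumes "(g has_vector_derivative d) (at 0)"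
  shows "(\<lambda>n. real (Suc n) *\<^sub>R (g (1 / real (Suc n)) - g 0)) \<longlonglongrightarrow> d"
proof -
  have "((\<lambda>h. norm (g (0 + h) - g 0 - h *\<^sub>R d) / norm h) \<longlongrightarrow> 0) (at 0)"
    using assms unfolding has_vector_derivative_def has_derivative_at by simp
  moreover have "filterlim (\<lambda>n. 1 / real (Suc n)) (at 0) sequentially"
    using LIMSEQ_inverse_real_of_nat
    by (auto simp: filterlim_at inverse_eq_divide intro!: always_eventually)
  ultimately have "(\<lambda>n. norm (g (0 + 1 / real (Suc n)) - g 0 - (1 / real (Suc n)) *\<^sub>R d) / norm (1 / real (Suc n))) \<longlonglongrightarrow> 0"
    by (rule filterlim_compose)
  moreover have "norm (g (0 + 1 / real (Suc n)) - g 0 - (1 / real (Suc n)) *\<^sub>R d) / norm (1 / real (Suc n))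
      = norm (real (Suc n) *\<^sub>R (g (1 / real (Suc n)) - g 0) - d)" for n
  proof -
    have "real (Suc n) *\<^sub>R (g (1 / real (Suc n)) - g 0) - d
        = real (Suc n) *\<^sub>R (g (1 / real (Suc n)) - g 0 - (1 / real (Suc n)) *\<^sub>R d)"
      by (simp add: scaleR_right_diff_distrib)
    then show ?thesis by (simp add: divide_inverse mult.commute)
  qed
  ultimately show ?thesis by (simp add: LIM_zero_iff tendsto_norm_zero_iff)
qed

lemma integral_translate:
  fixes F :: "'a::euclidean_space \<Rightarrow> 'b::{banach, second_countable_topology}"
  assumes [measurable]: "F \<in> borel_measurable borel"
  shows "(LINT x|lborel. F (x + t)) = (LINT x|lborel. F x)"
proof -
  have "(LINT x|lborel. F x) = (LINT x|distr lborel borel ((+) t). F x)"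
    by (simp add: lborel_distr_plus)
  also have "\<dots> = (LINT x|lborel. F (t + x))" by (subst integral_distr) auto
  finally show ?thesis by (simp add: add.commute)
qed

text \<open>
  Instead of integrating by parts, which would need Fubini and a choice of coordinates, the transform of
  the difference quotient of \<open>f\<close> in direction \<open>v\<close> is computed by translation invariance and then passed
  to the limit. The difference quotients are dominated because they are bounded by the supremum of the
  derivative and vanish outside a fixed ball.
\<close>

lemma fourier_deriv:
  fixes f :: "real ^ 'n::finite \<Rightarrow> complex"
  assumes f: "test_function f"
  shows "fourier (\<lambda>x. frechet_derivative f (at x) v) \<xi> = \<i> * complex_of_real (\<xi> \<bullet> v) * fourier f \<xi>"
proof -
  let ?D = "\<lambda>x. frechet_derivative f (at x) v"
  let ?e = "\<lambda>x. exp (- \<i> * complex_of_real (\<xi> \<bullet> x))"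
  define I where "I = (LINT x|lborel. f x * ?e x)"
  note [measurable] = test_function_measurable[OF f] test_function_measurable[OF test_function_deriv[OF f, of v]]
  have intf: "integrable lborel (\<lambda>x. f x * ?e x)"
    by (intro integrable_mult_unimodular test_function_integrable f) auto
  obtain M where M: "M \<ge> 0" "\<And>x. norm (?D x) \<le> M" using test_function_bounded[OF test_function_deriv[OF f, of v]] by blast
  obtain R where R: "R > 0" "\<And>x. f x \<noteq> 0 \<Longrightarrow> norm x \<le> R" using test_function_support[OF f] by blast
  have line: "((\<lambda>s. f (x + s *\<^sub>R v)) has_vector_derivative ?D (x + s *\<^sub>R v)) (at s within S)" for x s S
  proof -
    have lin: "linear (frechet_derivative f (at (x + s *\<^sub>R v)))"
      using test_function_has_derivative[OF f] has_derivative_linear by blast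
    have "((\<lambda>s. x + s *\<^sub>R v) has_derivative (\<lambda>h. h *\<^sub>R v)) (at s within S)"
      by (auto intro!: derivative_eq_intros)
    from has_derivative_compose[OF this test_function_has_derivative[OF f]]
    show ?thesis unfolding has_vector_derivative_def by (simp add: linear_cmul[OF lin])
  qed
  define q where "q n x = real (Suc n) *\<^sub>R (f (x + (1 / real (Suc n)) *\<^sub>R v) - f x)" for n x
  have q_lim: "(\<lambda>n. q n x) \<longlonglongrightarrow> ?D x" for x
    using directional_difference_quotient_limit[OF line[of x 0 UNIV, simplified]] by (simp add: q_def)
  have q_bound: "norm (q n x) \<le> M" for n x
  proof -
    have "norm (f (x + (1 / real (Suc n)) *\<^sub>R v) - f (x + 0 *\<^sub>R v)) \<le> M * norm (1 / real (Suc n) - 0)"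
    proof (rule differentiable_bound[where S=UNIV and f'="\<lambda>s h. h *\<^sub>R ?D (x + s *\<^sub>R v)" and f="\<lambda>s. f (x + s *\<^sub>R v)"])
      show "((\<lambda>s. f (x + s *\<^sub>R v)) has_derivative (\<lambda>h. h *\<^sub>R ?D (x + s *\<^sub>R v))) (at s)" for s
        using line[of x s UNIV] unfolding has_vector_derivative_def .
      show "onorm (\<lambda>h. h *\<^sub>R ?D (x + s *\<^sub>R v)) \<le> M" for s
        by (rule onorm_le) (simp, subst mult.commute, intro mult_right_mono M, simp)
    qed auto
    then show ?thesis by (simp add: q_def divide_simps mult.commute)
  qed
  have q_supp: "q n x = 0" if "norm x > R + norm v" for n x
  proof -
    have "norm ((1 / real (Suc n)) *\<^sub>R v) \<le> norm v"
      by (simp add: divide_simps mult_le_cancel_left1)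
    then have "norm (x + (1 / real (Suc n)) *\<^sub>R v) > R"
      using that norm_diff_ineq[of x "(1 / real (Suc n)) *\<^sub>R v"] by linarith
    then have "f (x + (1 / real (Suc n)) *\<^sub>R v) = 0" using R(2) by force
    moreover have "f x = 0" using R(2)[of x] that norm_ge_zero[of v] by force
    ultimately show ?thesis by (simp add: q_def)
  qed
  have "(\<lambda>n. LINT x|lborel. q n x * ?e x) \<longlonglongrightarrow> (LINT x|lborel. ?D x * ?e x)"
  proof (rule integral_dominated_convergence[where w="\<lambda>x. indicator (cball 0 (R + norm v)) x *\<^sub>R M"])
    show "(\<lambda>x. ?D x * ?e x) \<in> borel_measurable lborel" by measurable
    show "(\<lambda>x. q n x * ?e x) \<in> borel_measurable lborel" for n unfolding q_def by measurable
    show "integrable lborel (\<lambda>x::real^'n. indicator (cball 0 (R + norm v)) x *\<^sub>R M)"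
      by (intro borel_integrable_compact) auto
    show "AE x in lborel. (\<lambda>n. q n x * ?e x) \<longlonglongrightarrow> ?D x * ?e x"
      using q_lim by (auto intro!: tendsto_intros)
    show "AE x in lborel. norm (q n x * ?e x) \<le> indicator (cball 0 (R + norm v)) x *\<^sub>R M" for n
      using q_bound q_supp M by (auto simp: norm_mult indicator_def not_le)
  qed
  moreover have "(LINT x|lborel. q n x * ?e x)
      = real (Suc n) *\<^sub>R (exp (\<i> * complex_of_real (1 / real (Suc n) * (\<xi> \<bullet> v))) - 1) * I" for n
  proof -
    let ?t = "1 / real (Suc n)"
    have shift: "f (x + ?t *\<^sub>R v) * ?e x
        = exp (\<i> * complex_of_real (?t * (\<xi> \<bullet> v))) * (f (x + ?t *\<^sub>R v) * ?e (x + ?t *\<^sub>R v))" for x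
    proof -
      have "?e x = exp (\<i> * complex_of_real (?t * (\<xi> \<bullet> v))) * ?e (x + ?t *\<^sub>R v)"
        by (simp add: inner_add_right algebra_simps flip: exp_add)
      then show ?thesis by (simp add: ac_simps)
    qed
    have int_shift: "integrable lborel (\<lambda>x. f (x + ?t *\<^sub>R v) * ?e (x + ?t *\<^sub>R v))"
    proof -
      have "integrable (distr lborel borel ((+) (?t *\<^sub>R v))) (\<lambda>x. f x * ?e x)"
        using intf by (simp add: lborel_distr_plus)
      then show ?thesis by (subst (asm) integrable_distr_eq) (auto simp: add.commute)
    qed
    have "(LINT x|lborel. q n x * ?e x)
       = (LINT x|lborel. real (Suc n) *\<^sub>R (f (x + ?t *\<^sub>R v) * ?e x - f x * ?e x))"
      by (simp add: q_def left_diff_distrib)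
    also have "\<dots> = real (Suc n) *\<^sub>R ((LINT x|lborel. f (x + ?t *\<^sub>R v) * ?e x) - I)"
      unfolding I_def shift using intf int_shift by (subst integral_scaleR_right, subst Bochner_Integration.integral_diff) auto
    also have "(LINT x|lborel. f (x + ?t *\<^sub>R v) * ?e x)
       = exp (\<i> * complex_of_real (?t * (\<xi> \<bullet> v))) * I"
      unfolding shift I_def
      by (subst integral_mult_right_zero, subst integral_translate[of "\<lambda>x. f x * ?e x"]) auto
    finally show ?thesis by (simp add: algebra_simps)
  qed
  moreover have "(\<lambda>n. real (Suc n) *\<^sub>R (exp (\<i> * complex_of_real (1 / real (Suc n) * (\<xi> \<bullet> v))) - 1) * I)
     \<longlonglongrightarrow> (\<i> * complex_of_real (\<xi> \<bullet> v)) * I"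
  proof -
    have "((\<lambda>s. exp (\<i> * complex_of_real (s * (\<xi> \<bullet> v)))) has_vector_derivative \<i> * complex_of_real (\<xi> \<bullet> v)) (at 0)"
      by (auto intro!: derivative_eq_intros has_vector_derivative_real_field)
    from directional_difference_quotient_limit[OF this] show ?thesis
      by (intro tendsto_mult_right) simp
  qed
  ultimately have "(LINT x|lborel. ?D x * ?e x) = (\<i> * complex_of_real (\<xi> \<bullet> v)) * I"
    using LIMSEQ_unique by simp
  then show ?thesis by (simp add: fourier_def I_def ac_simps)
qed

text \<open>
  Differentiating twice in direction \<open>m\<close> multiplies the transform by \<open>-\<xi>\<^sub>m\<^sup>2\<close>. The hypothesis is
  required of all test functions so that it applies to this second derivative as well.
\<close>

lemma fourier_decay_step:
  fixes P :: "real ^ 'n::finite \<Rightarrow> real"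
  assumes D: "\<And>f :: real ^ 'n \<Rightarrow> complex. test_function f \<Longrightarrow> \<exists>C. \<forall>\<xi>. P \<xi> * norm (fourier f \<xi>) \<le> C"
    and f: "test_function (f :: real ^ 'n \<Rightarrow> complex)"
  shows "\<exists>C. \<forall>\<xi>. P \<xi> * (1 + (\<xi> $ m)\<^sup>2) * norm (fourier f \<xi>) \<le> C"
proof -
  define f1 where "f1 = (\<lambda>x. frechet_derivative f (at x) (axis m 1))"
  define f2 where "f2 = (\<lambda>x. frechet_derivative f1 (at x) (axis m 1))"
  have f1: "test_function f1" unfolding f1_def by (rule test_function_deriv[OF f])
  have f2: "test_function f2" unfolding f2_def by (rule test_function_deriv[OF f1])
  have n2: "norm (fourier f2 \<xi>) = (\<xi> $ m)\<^sup>2 * norm (fourier f \<xi>)" for \<xi>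
  proof -
    have "fourier f2 \<xi> = \<i> * complex_of_real (\<xi> $ m) * (\<i> * complex_of_real (\<xi> $ m) * fourier f \<xi>)"
      unfolding f2_def fourier_deriv[OF f1] unfolding f1_def fourier_deriv[OF f] by (simp add: inner_axis)
    then show ?thesis by (simp add: norm_mult power2_eq_square)
  qed
  obtain C where C: "\<And>\<xi>. P \<xi> * norm (fourier f \<xi>) \<le> C" using D[OF f] by blast
  obtain C' where C': "\<And>\<xi>. P \<xi> * norm (fourier f2 \<xi>) \<le> C'" using D[OF f2] by blast
  have "P \<xi> * (1 + (\<xi> $ m)\<^sup>2) * norm (fourier f \<xi>) \<le> C + C'" for \<xi>
    using C[of \<xi>] C'[of \<xi>] by (simp add: n2 algebra_simps)
  then show ?thesis by blast
qed

lemma fourier_decay: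
  fixes f :: "real ^ 'n::finite \<Rightarrow> complex"
  assumes "test_function f"
  shows "\<exists>C. \<forall>\<xi>. (\<Prod>m\<in>UNIV. (1 + (\<xi> $ m)\<^sup>2) ^ k) * norm (fourier f \<xi>) \<le> C"
proof -
  have base: "\<exists>C. \<forall>\<xi>. (1::real) * norm (fourier f \<xi>) \<le> C" for f :: "real ^ 'n \<Rightarrow> complex"
    using norm_fourier_le by auto
  have pow: "\<exists>C. \<forall>\<xi>. P \<xi> * (1 + (\<xi> $ m)\<^sup>2) ^ j * norm (fourier f \<xi>) \<le> C"
    if D: "\<And>f :: real ^ 'n \<Rightarrow> complex. test_function f \<Longrightarrow> \<exists>C. \<forall>\<xi>. P \<xi> * norm (fourier f \<xi>) \<le> C"
      and f: "test_function f"
    for P m j and f :: "real ^ 'n \<Rightarrow> complex"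
    using f
  proof (induction j arbitrary: f)
    case 0
    then show ?case using D by simp
  next
    case (Suc j)
    from fourier_decay_step[of "\<lambda>\<xi>. P \<xi> * (1 + (\<xi> $ m)\<^sup>2) ^ j", OF Suc.IH Suc.prems]
    show ?case by (simp add: ac_simps)
  qed
  have "\<exists>C. \<forall>\<xi>. (\<Prod>m\<in>S. (1 + (\<xi> $ m)\<^sup>2) ^ k) * norm (fourier f \<xi>) \<le> C"
    if "test_function f" for S and f :: "real ^ 'n \<Rightarrow> complex"
    using finite[of S] that
  proof (induction S arbitrary: f rule: finite_induct)
    case empty
    then show ?case using base by simp
  next
    case (insert m S)
    from pow[of "\<lambda>\<xi>. \<Prod>m\<in>S. (1 + (\<xi> $ m)\<^sup>2) ^ k", OF insert.IH insert.prems]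
    show ?case using insert.hyps by (simp add: ac_simps)
  qed
  then show ?thesis using assms by blast
qed

lemma nn_integral_inverse_1_plus_square_finite:
  "(\<integral>\<^sup>+u. ennreal (inverse (1 + u\<^sup>2)) \<partial>(lborel :: real measure)) < \<infinity>"
proof -
  have A: "(\<integral>\<^sup>+u. indicator {-1..1::real} u \<partial>lborel) < \<infinity>"
    by simp
  have B: "(\<integral>\<^sup>+u. ennreal (\<bar>u::real\<bar> powr (-2)) * indicator {u. 1 \<le> \<bar>u\<bar>} u \<partial>lborel) < \<infinity>"
    by (rule nn_integral_powr_away_0) auto
  have "(\<integral>\<^sup>+u. ennreal (inverse (1 + u\<^sup>2)) \<partial>(lborel :: real measure))
    \<le> (\<integral>\<^sup>+u. indicator {-1..1::real} u
          + ennreal (\<bar>u::real\<bar> powr (-2)) * indicator {u. 1 \<le> \<bar>u\<bar>} u \<partial>lborel)"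
  proof (rule nn_integral_mono)
    fix u :: real
    show "ennreal (inverse (1 + u\<^sup>2)) \<le> indicator {-1..1} u
          + ennreal (\<bar>u\<bar> powr (-2)) * indicator {u. 1 \<le> \<bar>u\<bar>} u"
    proof (cases "\<bar>u\<bar> \<ge> 1")
      case True
      have "inverse (1 + u\<^sup>2) \<le> inverse (u\<^sup>2)" using True by (intro le_imp_inverse_le) auto
      also have "\<dots> = \<bar>u\<bar> powr (-2)" using True by (auto simp: powr_minus)
      finally show ?thesis using True by (simp add: add_increasing ennreal_leI)
    next
      case False
      have "inverse (1 + u\<^sup>2) \<le> inverse 1" by (intro le_imp_inverse_le) auto
      then have "ennreal (inverse (1 + u\<^sup>2)) \<le> 1" by simp
      moreover have "u \<in> {-1..1}" using False by auto
      ultimately show ?thesis using False by simp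
    qed
  qed
  also have "\<dots> < \<infinity>" using A B by (subst nn_integral_add) auto
  finally show ?thesis .
qed

lemma integrable_prod_inverse_1_plus_square:
  "integrable lborel (\<lambda>\<xi>::real^'n::finite. \<Prod>m\<in>UNIV. inverse (1 + (\<xi> $ m)\<^sup>2))"
proof (rule integrableI_nonneg)
  show "(\<lambda>\<xi>::real^'n. \<Prod>m\<in>UNIV. inverse (1 + (\<xi> $ m)\<^sup>2)) \<in> borel_measurable lborel" by measurable
  show "AE \<xi> in (lborel :: (real^'n) measure). 0 \<le> (\<Prod>m\<in>UNIV. inverse (1 + (\<xi> $ m)\<^sup>2))"
    by (auto intro!: prod_nonneg)
  have "(\<integral>\<^sup>+\<xi>. ennreal (\<Prod>m\<in>UNIV. inverse (1 + (\<xi> $ m)\<^sup>2)) \<partial>(lborel :: (real^'n) measure))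
      = (\<Prod>m\<in>(UNIV :: 'n set). (\<integral>\<^sup>+u. ennreal (inverse (1 + u\<^sup>2)) \<partial>(lborel :: real measure)))"
    by (intro nn_integral_prod_coords) auto
  also have "\<dots> < \<infinity>"
    using nn_integral_inverse_1_plus_square_finite by (simp add: power_less_top_ennreal)
  finally show "(\<integral>\<^sup>+\<xi>. ennreal (\<Prod>m\<in>UNIV. inverse (1 + (\<xi> $ m)\<^sup>2)) \<partial>(lborel :: (real^'n) measure)) < \<infinity>" .
qed

lemma integrable_multiplier_fourier:
  fixes f :: "real ^ 'n::finite \<Rightarrow> complex" and a :: "real ^ 'n \<Rightarrow> real"
  assumes f: "test_function f" and [measurable]: "a \<in> borel_measurable borel"
    and a: "\<And>\<xi>. \<bar>a \<xi>\<bar> \<le> (\<Prod>m\<in>UNIV. (1 + (\<xi> $ m)\<^sup>2) ^ k)"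
  shows "integrable lborel (\<lambda>\<xi>. complex_of_real (a \<xi>) * fourier f \<xi>)"
proof -
  note [measurable] = test_function_measurable[OF f]
  obtain C where C: "\<And>\<xi>. (\<Prod>m\<in>UNIV. (1 + (\<xi> $ m)\<^sup>2) ^ Suc k) * norm (fourier f \<xi>) \<le> C"
    using fourier_decay[OF f] by blast
  show ?thesis
  proof (rule Bochner_Integration.integrable_bound)
    show "integrable lborel (\<lambda>\<xi>::real^'n. C * (\<Prod>m\<in>UNIV. inverse (1 + (\<xi> $ m)\<^sup>2)))"
      by (intro integrable_mult_right integrable_prod_inverse_1_plus_square)
    show "(\<lambda>\<xi>. complex_of_real (a \<xi>) * fourier f \<xi>) \<in> borel_measurable lborel" by measurable
    have "norm (complex_of_real (a \<xi>) * fourier f \<xi>) \<le> C * (\<Prod>m\<in>UNIV. inverse (1 + (\<xi> $ m)\<^sup>2))" for \<xi>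
    proof -
      have pos: "(1 + (\<xi> $ m)\<^sup>2) > 0" for m by (simp add: add_pos_nonneg)
      have "norm (complex_of_real (a \<xi>) * fourier f \<xi>) \<le> (\<Prod>m\<in>UNIV. (1 + (\<xi> $ m)\<^sup>2) ^ k) * norm (fourier f \<xi>)"
        by (simp add: norm_mult mult_right_mono a)
      also have "\<dots> = ((\<Prod>m\<in>UNIV. (1 + (\<xi> $ m)\<^sup>2) ^ Suc k) * norm (fourier f \<xi>)) * (\<Prod>m\<in>UNIV. inverse (1 + (\<xi> $ m)\<^sup>2))"
      proof -
        have "(\<Prod>m\<in>UNIV. (1 + (\<xi> $ m)\<^sup>2) ^ k) = (\<Prod>m\<in>UNIV. (1 + (\<xi> $ m)\<^sup>2) ^ Suc k) * (\<Prod>m\<in>UNIV. inverse (1 + (\<xi> $ m)\<^sup>2))"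
          unfolding prod.distrib[symmetric] using pos by (intro prod.cong refl) (simp add: less_imp_neq[symmetric])
        then show ?thesis by (simp add: ac_simps)
      qed
      also have "\<dots> \<le> C * (\<Prod>m\<in>UNIV. inverse (1 + (\<xi> $ m)\<^sup>2))"
        using pos by (intro mult_right_mono C prod_nonneg) (auto simp: less_imp_le)
      finally show ?thesis .
    qed
    then show "AE \<xi> in lborel. norm (complex_of_real (a \<xi>) * fourier f \<xi>) \<le> norm (C * (\<Prod>m\<in>UNIV. inverse (1 + (\<xi> $ m)\<^sup>2)))"
      unfolding real_norm_def by (intro AE_I2 order_trans[OF _ abs_ge_self])
  qed
qed

lemma integrable_fourier:
  fixes f :: "real ^ 'n::finite \<Rightarrow> complex"
  assumes "test_function f"
  shows "integrable lborel (fourier f)"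
  using integrable_multiplier_fourier[OF assms, of "\<lambda>_. 1" 0] by simp

lemma sum_le_prod_1_plus:
  fixes a :: "'i \<Rightarrow> real"
  assumes "finite S" "\<And>i. 0 \<le> a i"
  shows "1 + (\<Sum>i\<in>S. a i) \<le> (\<Prod>i\<in>S. 1 + a i)"
  using assms(1)
proof induction
  case (insert i S)
  have "1 + (a i + (\<Sum>i\<in>S. a i)) \<le> (1 + a i) * (1 + (\<Sum>i\<in>S. a i))"
    using assms(2) by (simp add: algebra_simps sum_nonneg)
  also have "\<dots> \<le> (1 + a i) * (\<Prod>i\<in>S. 1 + a i)"
    using insert.IH assms(2) by (intro mult_left_mono) auto
  finally show ?case using insert by simp
qed simp

lemma measurable_partial_symbol [measurable]:
  "partial_symbol A \<sigma> \<in> borel_measurable borel"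
  unfolding partial_symbol_def[abs_def] by measurable

text \<open>
  The rapid decay of the transform of a test function is available in product form, hence this form of
  the polynomial growth of the symbol.
\<close>

lemma partial_symbol_bound:
  fixes A :: "'n::finite set"
  assumes "\<sigma> > 0"
  shows "\<bar>partial_symbol A \<sigma> \<xi>\<bar> \<le> (\<Prod>m\<in>UNIV. (1 + (\<xi> $ m)\<^sup>2) ^ nat \<lceil>\<sigma> / 2\<rceil>)"
proof -
  let ?Q = "\<Prod>m\<in>UNIV. (1 + (\<xi> $ m)\<^sup>2)"
  have "(\<Sum>m\<in>A. (\<xi> $ m)\<^sup>2) \<le> (\<Sum>m\<in>UNIV. (\<xi> $ m)\<^sup>2)" by (intro sum_mono2) auto
  then have le: "(\<Sum>m\<in>A. (\<xi> $ m)\<^sup>2) \<le> ?Q" using sum_le_prod_1_plus[of UNIV "\<lambda>m. (\<xi> $ m)\<^sup>2"] by simp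
  have Q: "1 \<le> ?Q" by (intro prod_ge_1) auto
  have "\<bar>partial_symbol A \<sigma> \<xi>\<bar> = (\<Sum>m\<in>A. (\<xi> $ m)\<^sup>2) powr (\<sigma> / 2)"
    using assms by (simp add: partial_symbol_def)
  also have "\<dots> \<le> ?Q powr (\<sigma> / 2)" using le assms by (intro powr_mono2 sum_nonneg) auto
  also have "\<dots> \<le> ?Q powr real (nat \<lceil>\<sigma> / 2\<rceil>)" using Q assms by (intro powr_mono) auto
  also have "\<dots> = ?Q ^ nat \<lceil>\<sigma> / 2\<rceil>" using Q by (intro powr_realpow) auto
  finally show ?thesis by (simp add: prod_power_distrib)
qed

section \<open>Gaussian densities and Fourier inversion\<close>

text \<open>
  The centred Gaussian density with independent coordinates and standard deviations \<open>s m\<close>; distinct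
  deviations are needed to smooth in the variables of \<open>B\<close> only.
\<close>

definition gauss :: "('n::finite \<Rightarrow> real) \<Rightarrow> real ^ 'n \<Rightarrow> real" where
  "gauss s y = (\<Prod>m\<in>UNIV. normal_density 0 (s m) (y $ m))"

lemma gauss_nonneg [simp]: "0 \<le> gauss s y"
  by (auto simp: gauss_def intro!: prod_nonneg)

lemma measurable_gauss [measurable]: "gauss s \<in> borel_measurable borel"
  unfolding gauss_def[abs_def] by (intro measurable_prod_coords) measurable

lemma integral_prod_coords:
  fixes F :: "'n::finite \<Rightarrow> real \<Rightarrow> complex"
  assumes int: "\<And>m. integrable lborel (F m)"
  shows "integrable lborel (\<lambda>x::real^'n. \<Prod>m\<in>UNIV. F m (x $ m))"
    and "(LINT x|(lborel::(real^'n) measure). (\<Prod>m\<in>UNIV. F m (x $ m))) = (\<Prod>m\<in>UNIV. (LINT u|lborel. F m u))"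
proof -
  interpret product_sigma_finite "\<lambda>_::real^'n. lborel :: real measure" by standard
  define j :: "real^'n \<Rightarrow> 'n" where "j b = (SOME m. b = axis m 1)" for b
  have j: "j (axis m 1) = m" for m
    unfolding j_def by (rule some_equality) (auto simp: axis_eq_axis)
  have B: "(Basis :: (real^'n) set) = (\<lambda>m. axis m 1) ` UNIV" by (auto simp: Basis_vec_def)
  have inj: "inj (\<lambda>m::'n. axis m (1::real))" by (auto simp: inj_on_def axis_eq_axis)
  have [measurable]: "F m \<in> borel_measurable borel" for m
    using borel_measurable_integrable[OF int[of m]] by simp
  have comp: "(\<Sum>b\<in>Basis. f b *\<^sub>R b) $ m = f (axis m 1)" for f and m :: 'n
    unfolding B using inj by (simp add: sum.reindex axis_def if_distrib cong: if_cong)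
  have prodeq: "(\<Prod>m\<in>UNIV. F m ((\<Sum>b\<in>Basis. f b *\<^sub>R b) $ m)) = (\<Prod>b\<in>Basis. F (j b) (f b))" for f
    unfolding comp unfolding B using inj by (simp add: prod.reindex j)
  have T: "(\<lambda>f. \<Sum>b\<in>(Basis::(real^'n) set). f b *\<^sub>R b) \<in> measurable (\<Pi>\<^sub>M b\<in>Basis. lborel) borel"
    by measurable
  have M: "(\<lambda>x::real^'n. \<Prod>m\<in>UNIV. F m (x $ m)) \<in> borel_measurable borel"
    by measurable
  have "integrable (\<Pi>\<^sub>M b\<in>(Basis::(real^'n) set). lborel) (\<lambda>f. \<Prod>b\<in>Basis. F (j b) (f b))"
    by (intro product_integrable_prod int) auto
  then show "integrable lborel (\<lambda>x::real^'n. \<Prod>m\<in>UNIV. F m (x $ m))"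
    unfolding lborel_eq[where 'a="real^'n"] integrable_distr_eq[OF T M] prodeq .
  have "(LINT x|(lborel::(real^'n) measure). (\<Prod>m\<in>UNIV. F m (x $ m)))
      = (LINT f|(\<Pi>\<^sub>M b\<in>(Basis::(real^'n) set). lborel). (\<Prod>b\<in>Basis. F (j b) (f b)))"
    unfolding lborel_eq[where 'a="real^'n"] integral_distr[OF T M] prodeq ..
  also have "\<dots> = (\<Prod>b\<in>(Basis::(real^'n) set). (LINT u|lborel. F (j b) u))"
    by (intro product_integral_prod int) auto
  also have "\<dots> = (\<Prod>m\<in>UNIV. (LINT u|lborel. F m u))"
    unfolding B using inj by (simp add: prod.reindex j)
  finally show "(LINT x|(lborel::(real^'n) measure). (\<Prod>m\<in>UNIV. F m (x $ m))) = (\<Prod>m\<in>UNIV. (LINT u|lborel. F m u))" .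
qed

lemma normal_density_characteristic:
  fixes s \<eta> :: real
  assumes s: "s > 0"
  shows "integrable lborel (\<lambda>u. complex_of_real (normal_density 0 s u) * exp (\<i> * complex_of_real (u * \<eta>)))"
    and "(LINT u|lborel. complex_of_real (normal_density 0 s u) * exp (\<i> * complex_of_real (u * \<eta>)))
      = complex_of_real (exp (- (s * \<eta>)\<^sup>2 / 2))"
proof -
  show "integrable lborel (\<lambda>u. complex_of_real (normal_density 0 s u) * exp (\<i> * complex_of_real (u * \<eta>)))"
    using s by (intro integrable_mult_unimodular) (auto intro: integrable_normal_density)
  have std: "complex_of_real s * (complex_of_real (normal_density 0 s (s * u)) * exp (\<i> * complex_of_real (s * u * \<eta>)))
     = std_normal_density u *\<^sub>R iexp (s * \<eta> * u)" for u
  proof -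
    have "s * normal_density 0 s (s * u) = std_normal_density u"
      using s by (simp add: normal_density_def real_sqrt_mult power_mult_distrib)
    then show ?thesis
      by (simp add: scaleR_conv_of_real ac_simps flip: of_real_mult)
  qed
  have "(LINT u|lborel. complex_of_real (normal_density 0 s u) * exp (\<i> * complex_of_real (u * \<eta>)))
     = (LINT u|lborel. std_normal_density u *\<^sub>R iexp (s * \<eta> * u))"
    using s unfolding std[symmetric]
    by (subst lborel_integral_real_affine[where c=s and t=0]) (auto simp: scaleR_conv_of_real)
  also have "\<dots> = char std_normal_distribution (s * \<eta>)"
    unfolding char_def by (subst integral_density) auto
  finally show "(LINT u|lborel. complex_of_real (normal_density 0 s u) * exp (\<i> * complex_of_real (u * \<eta>)))
      = complex_of_real (exp (- (s * \<eta>)\<^sup>2 / 2))"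
    by (simp add: char_std_normal_distribution)
qed

lemma gauss_characteristic:
  fixes \<eta> :: "real ^ 'n::finite"
  assumes s: "\<And>m. s m > 0"
  shows "(LINT y|lborel. complex_of_real (gauss s y) * exp (\<i> * complex_of_real (y \<bullet> \<eta>)))
      = complex_of_real (exp (- (\<Sum>m\<in>UNIV. (s m * \<eta> $ m)\<^sup>2) / 2))"
proof -
  have split: "complex_of_real (gauss s y) * exp (\<i> * complex_of_real (y \<bullet> \<eta>))
      = (\<Prod>m\<in>UNIV. complex_of_real (normal_density 0 (s m) (y $ m)) * exp (\<i> * complex_of_real (y $ m * \<eta> $ m)))" for y
    by (simp add: gauss_def inner_vec_def prod.distrib sum_distrib_left exp_sum)
  have "(LINT y|lborel. complex_of_real (gauss s y) * exp (\<i> * complex_of_real (y \<bullet> \<eta>)))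
     = (\<Prod>m\<in>UNIV. complex_of_real (exp (- (s m * \<eta> $ m)\<^sup>2 / 2)))"
    unfolding split
    by (subst integral_prod_coords(2)) (use s normal_density_characteristic in auto)
  also have "\<dots> = complex_of_real (exp (- (\<Sum>m\<in>UNIV. (s m * \<eta> $ m)\<^sup>2) / 2))"
    by (simp add: exp_sum sum_divide_distrib flip: of_real_prod sum_negf)
  finally show ?thesis .
qed

lemma nn_integral_gauss:
  assumes "\<And>m. s m > 0"
  shows "(\<integral>\<^sup>+y. ennreal (gauss s y) \<partial>lborel) = 1"
  unfolding gauss_def using assms
  by (subst nn_integral_prod_coords) (auto simp: nn_integral_eq_integral)

lemma integrable_gauss:
  assumes "\<And>m. s m > 0"
  shows "integrable lborel (gauss s)"
  using nn_integral_gauss[of s, OF assms] by (intro integrableI_nonneg) auto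

lemma integral_gauss:
  assumes "\<And>m. s m > 0"
  shows "(LINT y|lborel. gauss s y) = 1"
  using nn_integral_gauss[of s, OF assms] by (simp add: integral_eq_nn_integral)

text \<open>
  The multiplication formula of Fourier analysis. It is used with \<open>K\<close> a character in the frequency
  variable, evaluated at \<open>x - y\<close> or at \<open>x - coord_proj B y\<close>.
\<close>

lemma integral_swap_unimodular:
  fixes f :: "'a::euclidean_space \<Rightarrow> complex" and g :: "'b::euclidean_space \<Rightarrow> complex"
  assumes f: "integrable lborel f" and g: "integrable lborel g"
    and [measurable]: "(\<lambda>(x, y). K x y) \<in> borel_measurable (borel \<Otimes>\<^sub>M borel)"
    and K: "\<And>x y. norm (K x y) = 1"
  shows "(LINT x|lborel. f x * (LINT y|lborel. g y * K x y)) = (LINT y|lborel. g y * (LINT x|lborel. f x * K x y))"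
proof -
  have [measurable]: "f \<in> borel_measurable borel" "g \<in> borel_measurable borel"
    using borel_measurable_integrable[OF f] borel_measurable_integrable[OF g] by simp_all
  have "integrable (lborel \<Otimes>\<^sub>M lborel) (\<lambda>(x, y). f x * (g y * K x y))"
  proof (rule lborel_pair.Fubini_integrable)
    show "(\<lambda>(x, y). f x * (g y * K x y)) \<in> borel_measurable (lborel \<Otimes>\<^sub>M lborel)"
      by measurable
    show "integrable lborel (\<lambda>x. LINT y|lborel. norm (case (x, y) of (x, y) \<Rightarrow> f x * (g y * K x y)))"
      using f by (simp add: norm_mult K)
    show "AE x in lborel. integrable lborel (\<lambda>y. case (x, y) of (x, y) \<Rightarrow> f x * (g y * K x y))"
      using g K by (auto intro!: integrable_mult_right integrable_mult_unimodular)
  qed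
  from lborel_pair.Fubini_integral[OF this]
  have "(LINT y|lborel. LINT x|lborel. f x * (g y * K x y)) = (LINT x|lborel. LINT y|lborel. f x * (g y * K x y))" .
  moreover have "(LINT x|lborel. f x * (g y * K x y)) = g y * (LINT x|lborel. f x * K x y)" for y
    unfolding mult.left_commute[of "f _" "g y"] by (rule integral_mult_right_zero)
  ultimately show ?thesis by simp
qed

lemma integral_affine:
  fixes h :: "'a::euclidean_space \<Rightarrow> 'b::{banach, second_countable_topology}"
  assumes c: "c \<noteq> 0" and [measurable]: "h \<in> borel_measurable borel"
  shows "(LINT y|lborel. h y) = \<bar>c\<bar> ^ DIM('a) *\<^sub>R (LINT z|lborel. h (t + c *\<^sub>R z))"
proof -
  have "(LINT y|lborel. h y) = (LINT y|density (distr lborel borel (\<lambda>x. t + c *\<^sub>R x)) (\<lambda>_. ennreal (\<bar>c\<bar> ^ DIM('a))). h y)"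
    using lborel_affine[OF c, of t] by simp
  also have "\<dots> = (LINT y|distr lborel borel (\<lambda>x. t + c *\<^sub>R x). (\<bar>c\<bar> ^ DIM('a)) *\<^sub>R h y)"
    by (intro integral_density) auto
  also have "\<dots> = (LINT z|lborel. (\<bar>c\<bar> ^ DIM('a)) *\<^sub>R h (t + c *\<^sub>R z))"
    by (intro integral_distr) auto
  finally show ?thesis by simp
qed

lemma gauss_const:
  fixes y :: "real ^ 'n::finite"
  assumes s: "s > 0"
  shows "gauss (\<lambda>_. s) y = (1 / (s * sqrt (2 * pi))) ^ CARD('n) * exp (- (\<Sum>m\<in>UNIV. (y $ m)\<^sup>2) / (2 * s\<^sup>2))"
proof -
  have nd: "normal_density 0 s u = 1 / (s * sqrt (2 * pi)) * exp (- u\<^sup>2 / (2 * s\<^sup>2))" for u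
    using s by (simp add: normal_density_def real_sqrt_mult ac_simps)
  have "exp (- (\<Sum>m\<in>UNIV. (y $ m)\<^sup>2) / (2 * s\<^sup>2)) = (\<Prod>m\<in>UNIV. exp (- (y $ m)\<^sup>2 / (2 * s\<^sup>2)))"
    by (simp add: sum_divide_distrib flip: exp_sum sum_negf)
  then show ?thesis
    unfolding gauss_def nd prod.distrib by simp
qed

lemma gauss_scale:
  fixes z :: "real ^ 'n::finite"
  assumes s: "s > 0"
  shows "s ^ CARD('n) * gauss (\<lambda>_. s) (s *\<^sub>R z) = gauss (\<lambda>_. 1) z"
proof -
  have "s * normal_density 0 s (s * u) = std_normal_density u" for u
    using s by (simp add: normal_density_def real_sqrt_mult power_mult_distrib)
  then have "(\<Prod>m\<in>UNIV. s * normal_density 0 s (s * z $ m)) = (\<Prod>m\<in>UNIV. std_normal_density (z $ m))"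
    by simp
  then show ?thesis by (simp add: gauss_def prod.distrib)
qed

text \<open>
  The Gaussian factor is itself the Fourier transform of a Gaussian, so the multiplication formula turns
  the damped inversion integral into an average of \<open>f\<close> around \<open>x\<close> at scale \<open>d\<close>.
\<close>

lemma gaussian_summation:
  fixes f :: "real ^ 'n::finite \<Rightarrow> complex"
  assumes f: "test_function f" and d: "d > 0"
  shows "complex_of_real ((2 * pi) powr (- real CARD('n) / 2)) *
     (LINT \<xi>|lborel. fourier f \<xi> * exp (\<i> * complex_of_real (\<xi> \<bullet> x)) *
        complex_of_real (exp (- d\<^sup>2 * (\<Sum>m\<in>UNIV. (\<xi> $ m)\<^sup>2) / 2)))
     = (LINT z|lborel. f (x - d *\<^sub>R z) * complex_of_real (gauss (\<lambda>_. 1) z))"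
proof -
  note [measurable] = test_function_measurable[OF f]
  define c where "c = (2 * pi) powr (- real CARD('n) / 2)"
  define L where "L = (sqrt (2 * pi) / d) ^ CARD('n)"
  define g where "g \<xi> = complex_of_real (exp (- d\<^sup>2 * (\<Sum>m\<in>UNIV. (\<xi> $ m)\<^sup>2) / 2))" for \<xi> :: "real ^ 'n"
  define K where "K \<xi> y = exp (\<i> * complex_of_real (\<xi> \<bullet> (x - y)))" for \<xi> y :: "real ^ 'n"
  have g: "g \<xi> = complex_of_real L * complex_of_real (gauss (\<lambda>_. 1/d) \<xi>)" for \<xi>
  proof -
    have "L * gauss (\<lambda>_. 1/d) \<xi> = exp (- d\<^sup>2 * (\<Sum>m\<in>UNIV. (\<xi> $ m)\<^sup>2) / 2)"
      using d by (subst gauss_const) (simp_all add: L_def power_divide mult.commute flip: power_mult_distrib)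
    then show ?thesis by (simp add: g_def flip: of_real_mult)
  qed
  have "integrable lborel (\<lambda>\<xi>::real^'n. complex_of_real (gauss (\<lambda>_. 1/d) \<xi>))"
    using integrable_gauss[of "\<lambda>_::'n. 1/d"] d by simp
  then have gint: "integrable lborel g" unfolding g[abs_def] by simp
  have cc: "c * c * (2 * pi) ^ CARD('n) = 1"
  proof -
    have "c * c = (2 * pi) powr (- real CARD('n))" by (simp add: c_def flip: powr_add)
    also have "\<dots> = inverse ((2 * pi) ^ CARD('n))" by (simp add: powr_minus powr_realpow)
    finally show ?thesis by (simp only: left_inverse power_not_zero mult_eq_0_iff pi_neq_zero zero_neq_numeral[symmetric] simp_thms)
  qed
  have F: "fourier f \<xi> * exp (\<i> * complex_of_real (\<xi> \<bullet> x)) = complex_of_real c * (LINT y|lborel. f y * K \<xi> y)" for \<xi>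
  proof -
    have eq: "f y * K \<xi> y = (f y * exp (- \<i> * complex_of_real (\<xi> \<bullet> y))) * exp (\<i> * complex_of_real (\<xi> \<bullet> x))" for y
      by (simp add: K_def inner_diff_right algebra_simps flip: exp_add)
    show ?thesis unfolding eq integral_mult_left_zero fourier_def c_def by (simp only: mult.assoc)
  qed
  have inner: "(LINT \<xi>|lborel. g \<xi> * K \<xi> y) = complex_of_real ((2 * pi) ^ CARD('n) * gauss (\<lambda>_. d) (x - y))" for y
  proof -
    have "(LINT \<xi>|lborel. g \<xi> * K \<xi> y)
      = complex_of_real L * (LINT \<xi>|lborel. complex_of_real (gauss (\<lambda>_. 1/d) \<xi>) * exp (\<i> * complex_of_real (\<xi> \<bullet> (x - y))))"
      unfolding g K_def mult.assoc by (rule integral_mult_right_zero)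
    also have "\<dots> = complex_of_real (L * exp (- (\<Sum>m\<in>UNIV. (1/d * (x - y) $ m)\<^sup>2) / 2))"
      using d by (subst gauss_characteristic) auto
    also have "L * exp (- (\<Sum>m\<in>UNIV. (1/d * (x - y) $ m)\<^sup>2) / 2) = (2 * pi) ^ CARD('n) * gauss (\<lambda>_. d) (x - y)"
    proof -
      have "(\<Sum>m\<in>UNIV. (1/d * (x - y) $ m)\<^sup>2) / 2 = (\<Sum>m\<in>UNIV. ((x - y) $ m)\<^sup>2) / (2 * d\<^sup>2)"
        by (simp add: power_divide sum_divide_distrib mult.commute)
      moreover have "L = (2 * pi) ^ CARD('n) * (1 / (d * sqrt (2 * pi))) ^ CARD('n)"
      proof -
        have "sqrt (2 * pi) / d = 2 * pi * (1 / (d * sqrt (2 * pi)))"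
          using d by (simp add: divide_simps)
        then show ?thesis by (simp only: L_def power_mult_distrib)
      qed
      ultimately show ?thesis using d by (simp add: gauss_const)
    qed
    finally show ?thesis .
  qed
  have "complex_of_real c * (LINT \<xi>|lborel. fourier f \<xi> * exp (\<i> * complex_of_real (\<xi> \<bullet> x)) * g \<xi>)
     = complex_of_real c * (LINT \<xi>|lborel. complex_of_real c * (g \<xi> * (LINT y|lborel. f y * K \<xi> y)))"
    unfolding F by (simp add: ac_simps)
  also have "\<dots> = complex_of_real (c * c) * (LINT \<xi>|lborel. g \<xi> * (LINT y|lborel. f y * K \<xi> y))"
    by (subst integral_mult_right_zero) simp
  also have "(LINT \<xi>|lborel. g \<xi> * (LINT y|lborel. f y * K \<xi> y)) = (LINT y|lborel. f y * (LINT \<xi>|lborel. g \<xi> * K \<xi> y))"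
  proof (rule integral_swap_unimodular[OF gint test_function_integrable[OF f]])
    show "(\<lambda>(\<xi>, y). K \<xi> y) \<in> borel_measurable (borel \<Otimes>\<^sub>M borel)" unfolding K_def by measurable
  qed (simp add: K_def)
  also have "\<dots> = (LINT y|lborel. complex_of_real ((2 * pi) ^ CARD('n)) * (f y * complex_of_real (gauss (\<lambda>_. d) (x - y))))"
    unfolding inner by (simp add: ac_simps)
  also have "\<dots> = complex_of_real ((2 * pi) ^ CARD('n)) * (LINT y|lborel. f y * complex_of_real (gauss (\<lambda>_. d) (x - y)))"
    by (rule integral_mult_right_zero)
  finally have "complex_of_real c * (LINT \<xi>|lborel. fourier f \<xi> * exp (\<i> * complex_of_real (\<xi> \<bullet> x)) * g \<xi>)
     = complex_of_real (c * c * (2 * pi) ^ CARD('n)) * (LINT y|lborel. f y * complex_of_real (gauss (\<lambda>_. d) (x - y)))"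
    by (simp add: mult.assoc)
  also have "\<dots> = (LINT y|lborel. f y * complex_of_real (gauss (\<lambda>_. d) (x - y)))" unfolding cc by simp
  also have "\<dots> = \<bar>- d\<bar> ^ DIM(real^'n) *\<^sub>R (LINT z|lborel. f (x + (- d) *\<^sub>R z) * complex_of_real (gauss (\<lambda>_. d) (x - (x + (- d) *\<^sub>R z))))"
    by (rule integral_affine) (use d in auto)
  also have "\<dots> = (LINT z|lborel. d ^ CARD('n) *\<^sub>R (f (x - d *\<^sub>R z) * complex_of_real (gauss (\<lambda>_. d) (d *\<^sub>R z))))"
    using d by simp
  also have "\<dots> = (LINT z|lborel. f (x - d *\<^sub>R z) * complex_of_real (d ^ CARD('n) * gauss (\<lambda>_. d) (d *\<^sub>R z)))"
    by (simp add: scaleR_conv_of_real ac_simps)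
  also have "\<dots> = (LINT z|lborel. f (x - d *\<^sub>R z) * complex_of_real (gauss (\<lambda>_. 1) z))"
    using d by (simp only: gauss_scale)
  finally show ?thesis by (simp add: c_def g_def)
qed

text \<open>
  Let \<open>d\<close> tend to \<open>0\<close> in \<open>gaussian_summation\<close>, with dominated convergence on both sides.
\<close>

lemma fourier_inversion:
  fixes f :: "real ^ 'n::finite \<Rightarrow> complex"
  assumes f: "test_function f"
  shows "inverse_fourier (fourier f) x = f x"
proof -
  note [measurable] = test_function_measurable[OF f]
  define d where "d n = 1 / real (Suc n)" for n
  have d: "d n > 0" for n by (simp add: d_def)
  have d0: "d \<longlonglongrightarrow> 0" unfolding d_def using LIMSEQ_inverse_real_of_nat by (simp add: inverse_eq_divide)
  define c where "c = complex_of_real ((2 * pi) powr (- real CARD('n) / 2))"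
  obtain M where M: "M \<ge> 0" "\<And>x. norm (f x) \<le> M" using test_function_bounded[OF f] by blast
  let ?q = "\<lambda>\<xi>::real^'n. \<Sum>m\<in>UNIV. (\<xi> $ m)\<^sup>2"
  have "(\<lambda>n. c * (LINT \<xi>|lborel. fourier f \<xi> * exp (\<i> * complex_of_real (\<xi> \<bullet> x)) * complex_of_real (exp (- (d n)\<^sup>2 * ?q \<xi> / 2))))
     \<longlonglongrightarrow> c * (LINT \<xi>|lborel. fourier f \<xi> * exp (\<i> * complex_of_real (\<xi> \<bullet> x)))"
  proof (intro tendsto_mult_left integral_dominated_convergence[where w="\<lambda>\<xi>. norm (fourier f \<xi>)"])
    show "integrable lborel (\<lambda>\<xi>. norm (fourier f \<xi>))" using integrable_fourier[OF f] by simp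
    show "AE \<xi> in lborel. (\<lambda>n. fourier f \<xi> * exp (\<i> * complex_of_real (\<xi> \<bullet> x)) * complex_of_real (exp (- (d n)\<^sup>2 * ?q \<xi> / 2)))
       \<longlonglongrightarrow> fourier f \<xi> * exp (\<i> * complex_of_real (\<xi> \<bullet> x))"
    proof (rule AE_I2)
      fix \<xi> :: "real^'n"
      have "(\<lambda>n. complex_of_real (exp (- (d n)\<^sup>2 * ?q \<xi> / 2))) \<longlonglongrightarrow> complex_of_real (exp (- 0\<^sup>2 * ?q \<xi> / 2))"
        by (intro tendsto_intros d0) simp
      from tendsto_mult_left[OF this, of "fourier f \<xi> * exp (\<i> * complex_of_real (\<xi> \<bullet> x))"]
      show "(\<lambda>n. fourier f \<xi> * exp (\<i> * complex_of_real (\<xi> \<bullet> x)) * complex_of_real (exp (- (d n)\<^sup>2 * ?q \<xi> / 2)))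
       \<longlonglongrightarrow> fourier f \<xi> * exp (\<i> * complex_of_real (\<xi> \<bullet> x))" by simp
    qed
    show "AE \<xi> in lborel. norm (fourier f \<xi> * exp (\<i> * complex_of_real (\<xi> \<bullet> x)) * complex_of_real (exp (- (d n)\<^sup>2 * ?q \<xi> / 2)))
       \<le> norm (fourier f \<xi>)" for n
      by (intro AE_I2) (auto simp: norm_mult intro!: mult_left_le sum_nonneg mult_nonneg_nonneg)
  qed measurable
  then have 1: "(\<lambda>n. LINT z|lborel. f (x - d n *\<^sub>R z) * complex_of_real (gauss (\<lambda>_. 1) z)) \<longlonglongrightarrow> inverse_fourier (fourier f) x"
    unfolding c_def gaussian_summation[OF f d] inverse_fourier_def .
  have 2: "(\<lambda>n. LINT z|lborel. f (x - d n *\<^sub>R z) * complex_of_real (gauss (\<lambda>_. 1) z))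
     \<longlonglongrightarrow> (LINT z|lborel. f x * complex_of_real (gauss (\<lambda>_::'n. 1) z))"
  proof (rule integral_dominated_convergence[where w="\<lambda>z::real^'n. M * gauss (\<lambda>_. 1) z"])
    show "integrable lborel (\<lambda>z::real^'n. M * gauss (\<lambda>_. 1) z)"
      by (intro integrable_mult_right integrable_gauss) simp
    show "AE z in lborel. (\<lambda>n. f (x - d n *\<^sub>R z) * complex_of_real (gauss (\<lambda>_. 1) z)) \<longlonglongrightarrow> f x * complex_of_real (gauss (\<lambda>_. 1) z)"
    proof (intro AE_I2 tendsto_mult tendsto_const)
      fix z
      have "isCont f x" using test_function_continuous[OF f] by (simp add: continuous_on_eq_continuous_at)
      moreover have "(\<lambda>n. x - d n *\<^sub>R z) \<longlonglongrightarrow> x - 0 *\<^sub>R z" by (intro tendsto_intros d0)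
      ultimately show "(\<lambda>n. f (x - d n *\<^sub>R z)) \<longlonglongrightarrow> f x" by (auto intro: isCont_tendsto_compose)
    qed
    show "AE z in lborel. norm (f (x - d n *\<^sub>R z) * complex_of_real (gauss (\<lambda>_. 1) z)) \<le> M * gauss (\<lambda>_. 1) z" for n
      using M by (auto simp: norm_mult intro!: mult_right_mono)
  qed measurable
  have "(LINT z|lborel. f x * complex_of_real (gauss (\<lambda>_::'n. 1) z)) = f x"
    by (simp add: integral_gauss)
  then show ?thesis using LIMSEQ_unique[OF 1 2] by simp
qed

section \<open>Fractional derivatives and Riesz potentials\<close>

lemma partial_symbol_eq_block_radius:
  assumes "\<sigma> > 0"
  shows "partial_symbol B \<sigma> \<xi> = block_radius B \<xi> powr \<sigma>"
  using assms by (simp add: partial_symbol_def block_radius_def powr_half_sqrt[symmetric] sum_nonneg powr_powr)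

lemma block_radius_nonneg [simp]: "0 \<le> block_radius B x"
  by (simp add: block_radius_def sum_nonneg)

lemma block_radius_sq: "(block_radius B x)\<^sup>2 = (\<Sum>m\<in>B. (x $ m)\<^sup>2)"
  by (simp add: block_radius_def sum_nonneg)

lemma measurable_block_radius [measurable]: "block_radius B \<in> borel_measurable borel"
  unfolding block_radius_def[abs_def] by measurable

lemma abs_coord_le_block_radius:
  assumes "m \<in> B"
  shows "\<bar>x $ m\<bar> \<le> block_radius B x"
  unfolding block_radius_def using assms by (intro real_le_rsqrt) (simp add: member_le_sum[of m B "\<lambda>m. (x $ m)\<^sup>2"])

lemma block_radius_pos:
  assumes "m \<in> B" "x $ m \<noteq> 0"
  shows "0 < block_radius B x"
  using abs_coord_le_block_radius[OF assms(1), of x] assms(2) by linarith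

text \<open>
  Damping the frequencies of \<open>B\<close> by a Gaussian is convolution in these variables with a Gaussian of
  width \<open>s\<close>. The width \<open>1\<close> in the other variables is arbitrary, since \<open>coord_proj B\<close> discards them.
\<close>

lemma partial_heat_flow:
  fixes G :: "real ^ 'n::finite \<Rightarrow> complex" and B :: "'n set"
  assumes G: "integrable lborel G" and s: "s > 0"
  shows "complex_of_real ((2 * pi) powr (- real CARD('n) / 2)) *
     (LINT \<xi>|lborel. G \<xi> * exp (\<i> * complex_of_real (\<xi> \<bullet> x)) * complex_of_real (exp (- (s * block_radius B \<xi>)\<^sup>2 / 2)))
    = (LINT y|lborel. complex_of_real (gauss (\<lambda>m. if m \<in> B then s else 1) y) * inverse_fourier G (x - coord_proj B y))"
proof -
  let ?\<rho> = "\<lambda>y. complex_of_real (gauss (\<lambda>m. if m \<in> B then s else 1) y)"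
  define c where "c = complex_of_real ((2 * pi) powr (- real CARD('n) / 2))"
  define K where "K \<xi> y = exp (\<i> * complex_of_real (\<xi> \<bullet> (x - coord_proj B y)))" for \<xi> y :: "real ^ 'n"
  have heat: "exp (\<i> * complex_of_real (\<xi> \<bullet> x)) * complex_of_real (exp (- (s * block_radius B \<xi>)\<^sup>2 / 2))
     = (LINT y|lborel. ?\<rho> y * K \<xi> y)" for \<xi>
  proof -
    let ?\<eta> = "- coord_proj B \<xi>"
    have "(s * block_radius B \<xi>)\<^sup>2 = (\<Sum>m\<in>UNIV. ((if m \<in> B then s else 1) * ?\<eta> $ m)\<^sup>2)"
    proof -
      have "(s * block_radius B \<xi>)\<^sup>2 = (\<Sum>m\<in>B. (s * \<xi> $ m)\<^sup>2)"
        by (simp add: power_mult_distrib block_radius_sq sum_distrib_left)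
      also have "\<dots> = (\<Sum>m\<in>UNIV. if m \<in> B then (s * \<xi> $ m)\<^sup>2 else 0)" by (simp add: sum.If_cases)
      also have "\<dots> = (\<Sum>m\<in>UNIV. ((if m \<in> B then s else 1) * ?\<eta> $ m)\<^sup>2)"
        by (intro sum.cong) auto
      finally show ?thesis .
    qed
    then have "complex_of_real (exp (- (s * block_radius B \<xi>)\<^sup>2 / 2))
        = (LINT y|lborel. ?\<rho> y * exp (\<i> * complex_of_real (y \<bullet> ?\<eta>)))"
      using s by (subst gauss_characteristic) auto
    then have "exp (\<i> * complex_of_real (\<xi> \<bullet> x)) * complex_of_real (exp (- (s * block_radius B \<xi>)\<^sup>2 / 2))
        = (LINT y|lborel. exp (\<i> * complex_of_real (\<xi> \<bullet> x)) * (?\<rho> y * exp (\<i> * complex_of_real (y \<bullet> ?\<eta>))))"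
      by (simp only: integral_mult_right_zero)
    also have "\<dots> = (LINT y|lborel. ?\<rho> y * K \<xi> y)"
    proof (rule Bochner_Integration.integral_cong[OF refl])
      fix y
      have "y \<bullet> ?\<eta> = - (\<xi> \<bullet> coord_proj B y)"
        unfolding inner_vec_def sum_negf[symmetric] by (intro sum.cong) auto
      then have "exp (\<i> * complex_of_real (\<xi> \<bullet> x)) * exp (\<i> * complex_of_real (y \<bullet> ?\<eta>)) = K \<xi> y"
        by (simp add: K_def inner_diff_right algebra_simps flip: exp_add)
      then show "exp (\<i> * complex_of_real (\<xi> \<bullet> x)) * (?\<rho> y * exp (\<i> * complex_of_real (y \<bullet> ?\<eta>))) = ?\<rho> y * K \<xi> y"
        by (simp add: mult.left_commute)
    qed
    finally show ?thesis .
  qed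
  have \<rho>: "integrable lborel (\<lambda>y::real^'n. ?\<rho> y)"
    using integrable_gauss[of "\<lambda>m::'n. if m \<in> B then s else 1"] s by simp
  have "c * (LINT \<xi>|lborel. G \<xi> * exp (\<i> * complex_of_real (\<xi> \<bullet> x)) * complex_of_real (exp (- (s * block_radius B \<xi>)\<^sup>2 / 2)))
    = c * (LINT \<xi>|lborel. G \<xi> * (LINT y|lborel. ?\<rho> y * K \<xi> y))"
    by (simp only: mult.assoc heat)
  also have "(LINT \<xi>|lborel. G \<xi> * (LINT y|lborel. ?\<rho> y * K \<xi> y)) = (LINT y|lborel. ?\<rho> y * (LINT \<xi>|lborel. G \<xi> * K \<xi> y))"
  proof (rule integral_swap_unimodular[OF G \<rho>])
    show "(\<lambda>(\<xi>, y). K \<xi> y) \<in> borel_measurable (borel \<Otimes>\<^sub>M borel)" unfolding K_def by measurable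
  qed (simp add: K_def)
  also have "c * \<dots> = (LINT y|lborel. ?\<rho> y * (c * (LINT \<xi>|lborel. G \<xi> * K \<xi> y)))"
    by (simp only: integral_mult_right_zero[symmetric] mult.left_commute)
  finally show ?thesis by (simp add: c_def inverse_fourier_def K_def)
qed

lemma nn_integral_gauss_moment_pos:
  "(\<integral>\<^sup>+u. ennreal (u powr (\<sigma> - 1) * exp (- u\<^sup>2 / 2)) * indicator {0<..} u \<partial>lborel) \<noteq> 0"
proof
  assume "(\<integral>\<^sup>+u. ennreal (u powr (\<sigma> - 1) * exp (- u\<^sup>2 / 2)) * indicator {0<..} u \<partial>lborel) = 0"
  then have "AE u in (lborel :: real measure). ennreal (u powr (\<sigma> - 1) * exp (- u\<^sup>2 / 2)) * indicator {0<..} u = 0"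
    by (subst (asm) nn_integral_0_iff_AE) auto
  then have "AE u in (lborel :: real measure). u \<notin> {0<..1}"
    by eventually_elim (auto simp: indicator_def split: if_splits)
  then have "{0<..1} \<in> null_sets (lborel :: real measure)"
    by (subst AE_iff_null_sets) auto
  then have "emeasure lborel {0<..(1::real)} = 0" by auto
  then show False by simp
qed

text \<open>
  In the inversion formula for \<open>f\<close>, replace the transform of \<open>f\<close> by \<open>|\<xi>\<^sub>B|\<^bsup>-\<sigma>\<^esup>\<close> times the transform \<open>G\<close>
  of the fractional derivative, and \<open>|\<xi>\<^sub>B|\<^bsup>-\<sigma>\<^esup>\<close> by a mixture of Gaussians. The resulting double integral
  converges absolutely, because its absolute value integrates to a multiple of the integral of
  \<open>|fourier f|\<close>. So the frequency integral may be done first, and it is a partial heat flow.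
\<close>

lemma riesz_potential_bound:
  fixes f :: "real ^ 'n::finite \<Rightarrow> complex" and B :: "'n set"
  assumes f: "test_function f" and \<sigma>: "\<sigma> > 0" and B: "B \<noteq> {}"
  shows "ennreal (norm (f x)) * (\<integral>\<^sup>+u. ennreal (u powr (\<sigma> - 1) * exp (- u\<^sup>2 / 2)) * indicator {0<..} u \<partial>lborel)
    \<le> (\<integral>\<^sup>+s. (\<integral>\<^sup>+y. ennreal (s powr (\<sigma> - 1) * gauss (\<lambda>m. if m \<in> B then s else 1) y *
          norm (frac_deriv B \<sigma> f (x - coord_proj B y))) \<partial>lborel) * indicator {0<..} s \<partial>lborel)"
proof -
  note [measurable] = test_function_measurable[OF f]
  let ?I = "\<integral>\<^sup>+u. ennreal (u powr (\<sigma> - 1) * exp (- u\<^sup>2 / 2)) * indicator {0<..} u \<partial>lborel"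
  obtain H where H: "?I = ennreal H" "H \<ge> 0"
    using gaussian_moment_finite[OF \<sigma>] by (cases ?I) auto
  define c where "c = (2 * pi) powr (- real CARD('n) / 2)"
  have c: "c > 0" by (simp add: c_def)
  define G where "G \<xi> = complex_of_real (partial_symbol B \<sigma> \<xi>) * fourier f \<xi>" for \<xi>
  have G: "integrable lborel G"
    unfolding G_def by (intro integrable_multiplier_fourier[OF f _ partial_symbol_bound[OF \<sigma>]]) measurable
  have [measurable]: "G \<in> borel_measurable borel" unfolding G_def by measurable
  define r where "r = (block_radius B :: real^'n \<Rightarrow> real)"
  have [measurable]: "r \<in> borel_measurable borel" unfolding r_def by measurable
  have rpos: "AE \<xi> in lborel. 0 < r \<xi>"
    using AE_coord_nonzero[of "\<lambda>_. 0"] by eventually_elim (use B in \<open>auto simp: r_def intro: block_radius_pos\<close>)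
  define e where "e \<xi> = exp (\<i> * complex_of_real (\<xi> \<bullet> x))" for \<xi> :: "real^'n"
  have [measurable]: "e \<in> borel_measurable borel" unfolding e_def by measurable
  have ne: "norm (e \<xi>) = 1" for \<xi> by (simp add: e_def)
  define w where "w s \<xi> = indicator {0<..} s * (s powr (\<sigma> - 1) * exp (- (s * r \<xi>)\<^sup>2 / 2))" for s :: real and \<xi>
  have w0: "0 \<le> w s \<xi>" for s \<xi> by (auto simp: w_def indicator_def)
  have [measurable]: "(\<lambda>(s, \<xi>). w s \<xi>) \<in> borel_measurable (borel \<Otimes>\<^sub>M borel)" unfolding w_def by measurable
  have wint: "(\<integral>\<^sup>+s. ennreal (w s \<xi>) \<partial>lborel) = ennreal (r \<xi> powr (- \<sigma>) * H)" if "0 < r \<xi>" for \<xi>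
  proof -
    have "(\<integral>\<^sup>+s. ennreal (w s \<xi>) \<partial>lborel)
       = (\<integral>\<^sup>+s. ennreal (s powr (\<sigma> - 1) * exp (- (s * r \<xi>)\<^sup>2 / 2)) * indicator {0<..} s \<partial>lborel)"
      by (intro nn_integral_cong) (auto simp: w_def indicator_def)
    also have "\<dots> = ennreal (r \<xi> powr (- \<sigma>) * H)"
      unfolding gaussian_moment_scale[OF that] H(1) by (simp add: ennreal_mult H(2))
    finally show ?thesis .
  qed
  have wL: "integrable lborel (\<lambda>s. w s \<xi>)" "(LINT s|lborel. w s \<xi>) = r \<xi> powr (- \<sigma>) * H" if "0 < r \<xi>" for \<xi>
  proof -
    show "integrable lborel (\<lambda>s. w s \<xi>)"
      by (rule integrableI_nonneg) (use w0 wint[OF that] in auto)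
    show "(LINT s|lborel. w s \<xi>) = r \<xi> powr (- \<sigma>) * H"
      using w0 wint[OF that] H(2) by (subst integral_eq_nn_integral) auto
  qed
  have GF: "r \<xi> powr (- \<sigma>) * norm (G \<xi>) = norm (fourier f \<xi>)"
           "complex_of_real (r \<xi> powr (- \<sigma>)) * G \<xi> = fourier f \<xi>" if "0 < r \<xi>" for \<xi>
  proof -
    have "r \<xi> powr (- \<sigma>) * partial_symbol B \<sigma> \<xi> = 1"
      unfolding partial_symbol_eq_block_radius[OF \<sigma>] r_def[symmetric] using that by (simp flip: powr_add)
    then show "complex_of_real (r \<xi> powr (- \<sigma>)) * G \<xi> = fourier f \<xi>"
      unfolding G_def mult.assoc[symmetric] by (simp flip: of_real_mult)
    then have "norm (complex_of_real (r \<xi> powr (- \<sigma>)) * G \<xi>) = norm (fourier f \<xi>)" by simp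
    then show "r \<xi> powr (- \<sigma>) * norm (G \<xi>) = norm (fourier f \<xi>)" by (simp add: norm_mult)
  qed
  define \<Phi> where "\<Phi> s \<xi> = complex_of_real (w s \<xi>) * (G \<xi> * e \<xi>)" for s \<xi>
  have n\<Phi>: "norm (\<Phi> s \<xi>) = w s \<xi> * norm (G \<xi>)" for s \<xi>
    using w0 by (simp add: \<Phi>_def norm_mult ne)
  have [measurable]: "(\<lambda>(s, \<xi>). \<Phi> s \<xi>) \<in> borel_measurable (borel \<Otimes>\<^sub>M borel)" unfolding \<Phi>_def by measurable
  have "integrable (lborel \<Otimes>\<^sub>M lborel) (\<lambda>(s, \<xi>). \<Phi> s \<xi>)"
  proof (rule integrableI_bounded)
    have "(\<integral>\<^sup>+z. ennreal (norm (case z of (s, \<xi>) \<Rightarrow> \<Phi> s \<xi>)) \<partial>(lborel \<Otimes>\<^sub>M lborel))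
       = (\<integral>\<^sup>+\<xi>. \<integral>\<^sup>+s. ennreal (norm (\<Phi> s \<xi>)) \<partial>lborel \<partial>lborel)"
      by (subst lborel_pair.nn_integral_snd[symmetric]) auto
    also have "\<dots> = (\<integral>\<^sup>+\<xi>. ennreal H * ennreal (norm (fourier f \<xi>)) \<partial>lborel)"
      using rpos
    proof (intro nn_integral_cong_AE, eventually_elim)
      fix \<xi> assume r: "0 < r \<xi>"
      have "(\<integral>\<^sup>+s. ennreal (norm (\<Phi> s \<xi>)) \<partial>lborel) = (\<integral>\<^sup>+s. ennreal (w s \<xi>) * ennreal (norm (G \<xi>)) \<partial>lborel)"
        using w0 by (simp add: n\<Phi> ennreal_mult)
      also have "\<dots> = ennreal (r \<xi> powr (- \<sigma>) * H) * ennreal (norm (G \<xi>))"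
        using wint[OF r] by (subst nn_integral_multc) auto
      also have "\<dots> = ennreal (H * (r \<xi> powr (- \<sigma>) * norm (G \<xi>)))"
        using H(2) by (simp add: ac_simps flip: ennreal_mult)
      finally show "(\<integral>\<^sup>+s. ennreal (norm (\<Phi> s \<xi>)) \<partial>lborel) = ennreal H * ennreal (norm (fourier f \<xi>))"
        using H(2) by (simp add: GF[OF r] ennreal_mult)
    qed
    also have "\<dots> = ennreal H * (\<integral>\<^sup>+\<xi>. ennreal (norm (fourier f \<xi>)) \<partial>lborel)"
      by (intro nn_integral_cmult) measurable
    also have "\<dots> < \<infinity>"
      using integrable_fourier[OF f] by (simp add: integrable_iff_bounded ennreal_mult_less_top)
    finally show "(\<integral>\<^sup>+z. ennreal (norm (case z of (s, \<xi>) \<Rightarrow> \<Phi> s \<xi>)) \<partial>(lborel \<Otimes>\<^sub>M lborel)) < \<infinity>" .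
  qed measurable
  note \<Phi> = this
  have "f x = complex_of_real c * (LINT \<xi>|lborel. fourier f \<xi> * e \<xi>)"
    using fourier_inversion[OF f, of x] by (simp add: inverse_fourier_def c_def e_def)
  then have "complex_of_real H * f x = complex_of_real c * (LINT \<xi>|lborel. complex_of_real H * (fourier f \<xi> * e \<xi>))"
    by simp
  also have "(LINT \<xi>|lborel. complex_of_real H * (fourier f \<xi> * e \<xi>)) = (LINT \<xi>|lborel. LINT s|lborel. \<Phi> s \<xi>)"
  proof (rule integral_cong_AE)
    show "(\<lambda>\<xi>. LINT s|lborel. \<Phi> s \<xi>) \<in> borel_measurable lborel" by measurable
    show "AE \<xi> in lborel. complex_of_real H * (fourier f \<xi> * e \<xi>) = (LINT s|lborel. \<Phi> s \<xi>)"
      using rpos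
    proof eventually_elim
      fix \<xi> assume r: "0 < r \<xi>"
      have "(LINT s|lborel. \<Phi> s \<xi>) = complex_of_real (LINT s|lborel. w s \<xi>) * (G \<xi> * e \<xi>)"
        unfolding \<Phi>_def by simp
      also have "\<dots> = complex_of_real H * ((complex_of_real (r \<xi> powr (- \<sigma>)) * G \<xi>) * e \<xi>)"
        unfolding wL[OF r] by simp
      finally show "complex_of_real H * (fourier f \<xi> * e \<xi>) = (LINT s|lborel. \<Phi> s \<xi>)"
        unfolding GF[OF r] ..
    qed
  qed measurable
  also have "\<dots> = (LINT s|lborel. LINT \<xi>|lborel. \<Phi> s \<xi>)"
    by (rule lborel_pair.Fubini_integral[OF \<Phi>])
  also have "complex_of_real c * \<dots> = (LINT s|lborel. complex_of_real c * (LINT \<xi>|lborel. \<Phi> s \<xi>))" by simp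
  finally have rep: "complex_of_real H * f x = (LINT s|lborel. complex_of_real c * (LINT \<xi>|lborel. \<Phi> s \<xi>))" .
  have "ennreal (norm (f x)) * ennreal H = ennreal (norm (complex_of_real H * f x))"
    using H(2) by (simp add: norm_mult ennreal_mult mult.commute)
  also have "\<dots> \<le> (\<integral>\<^sup>+s. norm (complex_of_real c * (LINT \<xi>|lborel. \<Phi> s \<xi>)) \<partial>lborel)"
    unfolding rep using lborel_pair.integrable_fst[OF \<Phi>] by (intro integral_norm_bound_ennreal) simp
  also have "\<dots> \<le> (\<integral>\<^sup>+s. (\<integral>\<^sup>+y. ennreal (s powr (\<sigma> - 1) * gauss (\<lambda>m. if m \<in> B then s else 1) y *
          norm (frac_deriv B \<sigma> f (x - coord_proj B y))) \<partial>lborel) * indicator {0<..} s \<partial>lborel)"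
  proof (rule nn_integral_mono)
    fix s :: real
    let ?\<rho> = "gauss (\<lambda>m. if m \<in> B then s else 1) :: real^'n \<Rightarrow> real"
    have fd: "frac_deriv B \<sigma> f = inverse_fourier G" by (simp add: frac_deriv_def G_def[abs_def])
    show "ennreal (norm (complex_of_real c * (LINT \<xi>|lborel. \<Phi> s \<xi>)))
      \<le> (\<integral>\<^sup>+y. ennreal (s powr (\<sigma> - 1) * ?\<rho> y * norm (frac_deriv B \<sigma> f (x - coord_proj B y))) \<partial>lborel) * indicator {0<..} s"
    proof (cases "s > 0")
      case False
      then have "\<Phi> s \<xi> = 0" for \<xi> by (simp add: \<Phi>_def w_def)
      then show ?thesis by simp
    next
      case True
      have "\<Phi> s \<xi> = complex_of_real (s powr (\<sigma> - 1)) * (G \<xi> * e \<xi> * complex_of_real (exp (- (s * r \<xi>)\<^sup>2 / 2)))" for \<xi>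
        using True by (simp add: \<Phi>_def w_def ac_simps)
      then have "complex_of_real c * (LINT \<xi>|lborel. \<Phi> s \<xi>)
        = complex_of_real (s powr (\<sigma> - 1)) * (complex_of_real c * (LINT \<xi>|lborel. G \<xi> * e \<xi> * complex_of_real (exp (- (s * r \<xi>)\<^sup>2 / 2))))"
        by simp
      also have "complex_of_real c * (LINT \<xi>|lborel. G \<xi> * e \<xi> * complex_of_real (exp (- (s * r \<xi>)\<^sup>2 / 2)))
        = (LINT y|lborel. complex_of_real (?\<rho> y) * inverse_fourier G (x - coord_proj B y))"
        unfolding c_def e_def r_def by (rule partial_heat_flow[OF G True])
      finally have eq: "complex_of_real c * (LINT \<xi>|lborel. \<Phi> s \<xi>)
        = complex_of_real (s powr (\<sigma> - 1)) * (LINT y|lborel. complex_of_real (?\<rho> y) * inverse_fourier G (x - coord_proj B y))" .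
      have "ennreal (norm (LINT y|lborel. complex_of_real (?\<rho> y) * inverse_fourier G (x - coord_proj B y)))
        \<le> (\<integral>\<^sup>+y. norm (complex_of_real (?\<rho> y) * inverse_fourier G (x - coord_proj B y)) \<partial>lborel)"
        by (cases "integrable lborel (\<lambda>y. complex_of_real (?\<rho> y) * inverse_fourier G (x - coord_proj B y))")
           (simp_all add: integral_norm_bound_ennreal not_integrable_integral_eq)
      then have "ennreal (norm (complex_of_real c * (LINT \<xi>|lborel. \<Phi> s \<xi>)))
        \<le> ennreal (s powr (\<sigma> - 1)) * (\<integral>\<^sup>+y. norm (complex_of_real (?\<rho> y) * inverse_fourier G (x - coord_proj B y)) \<partial>lborel)"
        unfolding eq norm_mult[of "complex_of_real (s powr (\<sigma> - 1))"] by (simp add: ennreal_mult mult_left_mono)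
      also have "\<dots> = (\<integral>\<^sup>+y. ennreal (s powr (\<sigma> - 1)) * norm (complex_of_real (?\<rho> y) * inverse_fourier G (x - coord_proj B y)) \<partial>lborel)"
        by (intro nn_integral_cmult[symmetric]) measurable
      also have "\<dots> = (\<integral>\<^sup>+y. ennreal (s powr (\<sigma> - 1) * ?\<rho> y * norm (frac_deriv B \<sigma> f (x - coord_proj B y))) \<partial>lborel)"
        unfolding fd by (intro nn_integral_cong) (simp add: norm_mult mult.assoc flip: ennreal_mult)
      finally show ?thesis using True by simp
    qed
  qed
  finally show ?thesis unfolding H(1) .
qed

text \<open>
  For \<open>s > 0\<close> the Gaussian equals \<open>s\<^bsup>-d\<^esup> exp (-|y\<^sub>B|\<^sup>2 / (2 s\<^sup>2))\<close> up to factors free of \<open>s\<close>, where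
  \<open>d = card B\<close>. So the mixture is a multiple of \<open>|y\<^sub>B|\<^bsup>-a\<^esup>\<close> with \<open>a = \<Sum>\<^sub>m (1 - \<gamma>\<^sub>m)\<close>, and the negative
  power of \<open>|y\<^sub>B|\<close> is distributed over the coordinates using \<open>|y\<^sub>m| \<le> |y\<^sub>B|\<close>.
\<close>

lemma gauss_scale_mixture_bound:
  fixes B :: "'n::finite set"
  assumes B: "B \<noteq> {}" and \<gamma>: "\<And>m. m \<in> B \<Longrightarrow> \<gamma> m < 1"
  obtains C :: real where "C > 0" "\<And>y :: real^'n. (\<forall>m. y $ m \<noteq> 0) \<Longrightarrow>
     (\<integral>\<^sup>+s. ennreal (s powr ((\<Sum>m\<in>B. \<gamma> m) - 1) * gauss (\<lambda>m. if m \<in> B then s else 1) y) * indicator {0<..} s \<partial>lborel)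
       \<le> ennreal (C * riesz_gauss_kernel B \<gamma> y)"
proof -
  define a where "a = (\<Sum>m\<in>B. 1 - \<gamma> m)"
  have a: "a > 0" unfolding a_def using B \<gamma> by (intro sum_pos) auto
  have a': "(\<Sum>m\<in>B. \<gamma> m) = real (card B) - a" by (simp add: a_def sum_subtractf)
  let ?J = "\<integral>\<^sup>+u. ennreal (u powr (- a - 1) * exp (- 1 / (2 * u\<^sup>2))) * indicator {0<..} u \<partial>lborel"
  obtain J where J: "?J = ennreal J" "J \<ge> 0"
    using inverse_gaussian_moment_finite[OF a] by (cases ?J) auto
  define q where "q = (1 / sqrt (2 * pi)) ^ card B"
  have q: "q > 0" by (simp add: q_def)
  show ?thesis
  proof (rule that[of "q * (J + 1)"])
    show "q * (J + 1) > 0" using q J by simp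
    fix y :: "real^'n" assume y: "\<forall>m. y $ m \<noteq> 0"
    define \<phi> where "\<phi> = (\<Prod>m\<in>-B. std_normal_density (y $ m))"
    define R where "R = block_radius B y"
    have \<phi>: "0 \<le> \<phi>" by (auto simp: \<phi>_def intro!: prod_nonneg)
    have R: "R > 0" using B y unfolding R_def by (auto intro: block_radius_pos)
    have split: "(\<Prod>m\<in>UNIV. if m \<in> B then F m else E m) = (\<Prod>m\<in>B. F m) * (\<Prod>m\<in>-B. E m)" for F E :: "'n \<Rightarrow> real"
      by (simp add: prod.If_cases Compl_eq)
    have g: "gauss (\<lambda>m. if m \<in> B then s else 1) y = \<phi> * q * s powr (- real (card B)) * exp (- R\<^sup>2 / (2 * s\<^sup>2))" if s: "s > 0" for s
    proof -
      have nd: "normal_density 0 s u = 1 / sqrt (2 * pi) * (1 / s) * exp (- u\<^sup>2 / (2 * s\<^sup>2))" for u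
        using s by (simp add: normal_density_def real_sqrt_mult ac_simps)
      have "exp (- R\<^sup>2 / (2 * s\<^sup>2)) = (\<Prod>m\<in>B. exp (- (y $ m)\<^sup>2 / (2 * s\<^sup>2)))"
        unfolding R_def block_radius_sq by (simp add: sum_divide_distrib flip: exp_sum sum_negf)
      moreover have "(1 / s) ^ card B = s powr (- real (card B))"
        using s by (simp add: powr_minus powr_realpow power_one_over inverse_eq_divide)
      ultimately have "(\<Prod>m\<in>B. normal_density 0 s (y $ m)) = q * s powr (- real (card B)) * exp (- R\<^sup>2 / (2 * s\<^sup>2))"
        unfolding nd prod.distrib by (simp add: q_def)
      moreover have "gauss (\<lambda>m. if m \<in> B then s else 1) y
          = (\<Prod>m\<in>UNIV. if m \<in> B then normal_density 0 s (y $ m) else std_normal_density (y $ m))"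
        unfolding gauss_def by (intro prod.cong) auto
      ultimately show ?thesis by (simp add: split \<phi>_def)
    qed
    have "(\<integral>\<^sup>+s. ennreal (s powr ((\<Sum>m\<in>B. \<gamma> m) - 1) * gauss (\<lambda>m. if m \<in> B then s else 1) y) * indicator {0<..} s \<partial>lborel)
      = (\<integral>\<^sup>+s. ennreal (\<phi> * q) * (ennreal (s powr (- a - 1) * exp (- R\<^sup>2 / (2 * s\<^sup>2))) * indicator {0<..} s) \<partial>lborel)"
    proof (intro nn_integral_cong)
      fix s :: real
      show "ennreal (s powr ((\<Sum>m\<in>B. \<gamma> m) - 1) * gauss (\<lambda>m. if m \<in> B then s else 1) y) * indicator {0<..} s
        = ennreal (\<phi> * q) * (ennreal (s powr (- a - 1) * exp (- R\<^sup>2 / (2 * s\<^sup>2))) * indicator {0<..} s)"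
      proof (cases "s > 0")
        case True
        have "s powr (- a - 1) = s powr (real (card B) - a - 1) * s powr (- real (card B))"
          by (subst powr_add[symmetric]) simp
        then have "s powr ((\<Sum>m\<in>B. \<gamma> m) - 1) * gauss (\<lambda>m. if m \<in> B then s else 1) y
          = \<phi> * q * (s powr (- a - 1) * exp (- R\<^sup>2 / (2 * s\<^sup>2)))"
          unfolding g[OF True] a' by (simp only: ac_simps)
        then show ?thesis using True \<phi> q by (simp add: ennreal_mult)
      qed simp
    qed
    also have "\<dots> = ennreal (\<phi> * q) * (ennreal (R powr (- a)) * ennreal J)"
      unfolding J(1)[symmetric] inverse_gaussian_moment_scale[OF R, symmetric]
      by (intro nn_integral_cmult) measurable
    also have "\<dots> = ennreal (\<phi> * q * J * R powr (- a))"
      using \<phi> q J by (simp add: ac_simps flip: ennreal_mult)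
    also have "\<dots> \<le> ennreal (\<phi> * q * (J + 1) * (\<Prod>m\<in>B. \<bar>y $ m\<bar> powr (\<gamma> m - 1)))"
    proof (intro ennreal_leI mult_mono)
      have "R powr (- a) = (\<Prod>m\<in>B. R powr (\<gamma> m - 1))"
        using R by (simp add: powr_sum a_def flip: sum_negf)
      also have "\<dots> \<le> (\<Prod>m\<in>B. \<bar>y $ m\<bar> powr (\<gamma> m - 1))"
      proof (intro prod_mono conjI)
        fix m assume m: "m \<in> B"
        have "\<bar>y $ m\<bar> \<le> R" unfolding R_def by (rule abs_coord_le_block_radius[OF m])
        then show "R powr (\<gamma> m - 1) \<le> \<bar>y $ m\<bar> powr (\<gamma> m - 1)"
          using y \<gamma>[OF m] by (intro powr_mono2') auto
      qed simp
      finally show "R powr (- a) \<le> (\<Prod>m\<in>B. \<bar>y $ m\<bar> powr (\<gamma> m - 1))" .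
    qed (use \<phi> q J in auto)
    also have "\<phi> * q * (J + 1) * (\<Prod>m\<in>B. \<bar>y $ m\<bar> powr (\<gamma> m - 1)) = q * (J + 1) * riesz_gauss_kernel B \<gamma> y"
      unfolding riesz_gauss_kernel_def split \<phi>_def by simp
    finally show "(\<integral>\<^sup>+s. ennreal (s powr ((\<Sum>m\<in>B. \<gamma> m) - 1) * gauss (\<lambda>m. if m \<in> B then s else 1) y) * indicator {0<..} s \<partial>lborel)
      \<le> ennreal (q * (J + 1) * riesz_gauss_kernel B \<gamma> y)" .
  qed
qed

lemma measurable_gauss_scale [measurable]:
  "(\<lambda>(s, y). gauss (\<lambda>m. if m \<in> B then s else 1) y) \<in> borel_measurable (borel \<Otimes>\<^sub>M borel)"
proof -
  have "(\<lambda>(s, y). normal_density 0 (if m \<in> B then s else 1) (y $ m)) \<in> borel_measurable (borel \<Otimes>\<^sub>M borel)" for m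
    by (cases "m \<in> B") (simp_all add: normal_density_def)
  then show ?thesis unfolding gauss_def by measurable
qed

text \<open>
  Exchanging the order of integration in \<open>riesz_potential_bound\<close> leaves a mixture of Gaussians as
  the kernel.
\<close>

lemma pointwise_riesz_bound:
  fixes B :: "'n::finite set"
  assumes B: "B \<noteq> {}" and \<gamma>: "\<And>m. m \<in> B \<Longrightarrow> 0 < \<gamma> m \<and> \<gamma> m < 1"
  obtains C :: real where "C > 0"
    "\<And>(f :: real ^ 'n \<Rightarrow> complex) x. test_function f \<Longrightarrow> ennreal (norm (f x)) \<le>
       (\<integral>\<^sup>+y. ennreal (riesz_gauss_kernel B \<gamma> y * (C * norm (frac_deriv B (\<Sum>m\<in>B. \<gamma> m) f (x - coord_proj B y)))) \<partial>lborel)"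
proof -
  define \<sigma> where "\<sigma> = (\<Sum>m\<in>B. \<gamma> m)"
  have \<sigma>: "\<sigma> > 0" unfolding \<sigma>_def using B \<gamma> by (intro sum_pos) auto
  let ?I = "\<integral>\<^sup>+u. ennreal (u powr (\<sigma> - 1) * exp (- u\<^sup>2 / 2)) * indicator {0<..} u \<partial>lborel"
  obtain H where H: "?I = ennreal H" "H > 0"
    using gaussian_moment_finite[OF \<sigma>] nn_integral_gauss_moment_pos[of \<sigma>]
    by (cases ?I) (auto simp: less_le)
  obtain C where C: "C > 0" "\<And>y :: real^'n. (\<forall>m. y $ m \<noteq> 0) \<Longrightarrow>
     (\<integral>\<^sup>+s. ennreal (s powr (\<sigma> - 1) * gauss (\<lambda>m. if m \<in> B then s else 1) y) * indicator {0<..} s \<partial>lborel)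
       \<le> ennreal (C * riesz_gauss_kernel B \<gamma> y)"
    using gauss_scale_mixture_bound[OF B, of \<gamma>] \<gamma> unfolding \<sigma>_def by blast
  show ?thesis
  proof (rule that[of "C / H"])
    show "C / H > 0" using C H by simp
    fix f :: "real ^ 'n \<Rightarrow> complex" and x assume f: "test_function f"
    note [measurable] = test_function_measurable[OF f]
    define g where "g = frac_deriv B \<sigma> f"
    have [measurable]: "g \<in> borel_measurable borel" unfolding g_def frac_deriv_def by measurable
    let ?\<rho> = "\<lambda>s. gauss (\<lambda>m. if m \<in> B then s else 1) :: real^'n \<Rightarrow> real"
    have "ennreal (norm (f x)) * ennreal H
      \<le> (\<integral>\<^sup>+s. (\<integral>\<^sup>+y. ennreal (s powr (\<sigma> - 1) * ?\<rho> s y * norm (g (x - coord_proj B y))) \<partial>lborel) * indicator {0<..} s \<partial>lborel)"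
      using riesz_potential_bound[OF f \<sigma> B, of x] unfolding H(1) g_def .
    also have "\<dots> = (\<integral>\<^sup>+s. \<integral>\<^sup>+y. (ennreal (s powr (\<sigma> - 1) * ?\<rho> s y) * indicator {0<..} s) * ennreal (norm (g (x - coord_proj B y))) \<partial>lborel \<partial>lborel)"
    proof (rule nn_integral_cong)
      fix s :: real
      show "(\<integral>\<^sup>+y. ennreal (s powr (\<sigma> - 1) * ?\<rho> s y * norm (g (x - coord_proj B y))) \<partial>lborel) * indicator {0<..} s
        = (\<integral>\<^sup>+y. (ennreal (s powr (\<sigma> - 1) * ?\<rho> s y) * indicator {0<..} s) * ennreal (norm (g (x - coord_proj B y))) \<partial>lborel)"
        by (subst nn_integral_multc[symmetric]) (auto simp: ennreal_mult ac_simps)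
    qed
    also have "\<dots> = (\<integral>\<^sup>+y. \<integral>\<^sup>+s. (ennreal (s powr (\<sigma> - 1) * ?\<rho> s y) * indicator {0<..} s) * ennreal (norm (g (x - coord_proj B y))) \<partial>lborel \<partial>lborel)"
      by (rule lborel_pair.Fubini') measurable
    also have "\<dots> = (\<integral>\<^sup>+y. (\<integral>\<^sup>+s. ennreal (s powr (\<sigma> - 1) * ?\<rho> s y) * indicator {0<..} s \<partial>lborel) * ennreal (norm (g (x - coord_proj B y))) \<partial>lborel)"
      by (intro nn_integral_cong nn_integral_multc) measurable
    also have "\<dots> \<le> (\<integral>\<^sup>+y. ennreal (C * riesz_gauss_kernel B \<gamma> y) * ennreal (norm (g (x - coord_proj B y))) \<partial>lborel)"
      using AE_coord_nonzero[of "\<lambda>_. 0"]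
      by (intro nn_integral_mono_AE, eventually_elim) (intro mult_right_mono C, auto)
    finally have le: "ennreal (norm (f x)) * ennreal H
      \<le> (\<integral>\<^sup>+y. ennreal (C * riesz_gauss_kernel B \<gamma> y) * ennreal (norm (g (x - coord_proj B y))) \<partial>lborel)" .
    have "ennreal (norm (f x)) = ennreal (1 / H) * (ennreal (norm (f x)) * ennreal H)"
      using H(2) by (simp flip: ennreal_mult)
    also have "\<dots> \<le> ennreal (1 / H) * (\<integral>\<^sup>+y. ennreal (C * riesz_gauss_kernel B \<gamma> y) * ennreal (norm (g (x - coord_proj B y))) \<partial>lborel)"
      by (intro mult_left_mono le) simp
    also have "\<dots> = (\<integral>\<^sup>+y. ennreal (1 / H) * (ennreal (C * riesz_gauss_kernel B \<gamma> y) * ennreal (norm (g (x - coord_proj B y)))) \<partial>lborel)"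
      by (intro nn_integral_cmult[symmetric]) measurable
    also have "\<dots> = (\<integral>\<^sup>+y. ennreal (riesz_gauss_kernel B \<gamma> y * (C / H * norm (g (x - coord_proj B y)))) \<partial>lborel)"
      using H(2) C(1) by (intro nn_integral_cong) (simp add: ac_simps flip: ennreal_mult)
    finally show "ennreal (norm (f x)) \<le>
       (\<integral>\<^sup>+y. ennreal (riesz_gauss_kernel B \<gamma> y * (C / H * norm (frac_deriv B (\<Sum>m\<in>B. \<gamma> m) f (x - coord_proj B y)))) \<partial>lborel)"
      unfolding g_def \<sigma>_def .
  qed
qed

section \<open>The weighted inequality\<close>

lemma Lp_norm_le:
  assumes p: "p > 0" and C: "C > 0"
    and le: "(\<integral>\<^sup>+x. ennreal (norm (F x) powr p) \<partial>lborel) \<le> ennreal C * (\<integral>\<^sup>+x. ennreal (norm (G x) powr p) \<partial>lborel)"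
  shows "Lp_norm p F \<le> ennreal (C powr (1 / p)) * Lp_norm p G"
proof (cases "(\<integral>\<^sup>+x. ennreal (norm (G x) powr p) \<partial>lborel) = \<infinity>")
  case True
  then show ?thesis using C by (simp add: Lp_norm_def ennreal_mult_top)
next
  case False
  then obtain b where b: "(\<integral>\<^sup>+x. ennreal (norm (G x) powr p) \<partial>lborel) = ennreal b" "b \<ge> 0"
    by (cases "\<integral>\<^sup>+x. ennreal (norm (G x) powr p) \<partial>lborel") auto
  have le': "(\<integral>\<^sup>+x. ennreal (norm (F x) powr p) \<partial>lborel) \<le> ennreal (C * b)"
    using le b C by (simp add: ennreal_mult)
  then obtain a where a: "(\<integral>\<^sup>+x. ennreal (norm (F x) powr p) \<partial>lborel) = ennreal a" "a \<ge> 0"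
    by (cases "\<integral>\<^sup>+x. ennreal (norm (F x) powr p) \<partial>lborel") (auto simp: top_unique)
  have "a \<le> C * b" using le' a b C by simp
  then have "a powr (1 / p) \<le> (C * b) powr (1 / p)" using a p by (intro powr_mono2) auto
  also have "\<dots> = C powr (1 / p) * b powr (1 / p)" using C b by (simp add: powr_mult)
  finally show ?thesis using a b by (simp add: Lp_norm_def ennreal_leI flip: ennreal_mult)
qed

theorem theorem1p2:
  fixes N :: nat and k :: "nat \<Rightarrow> nat" and A :: "nat \<Rightarrow> 'n::finite set"
    and p :: real and \<alpha> :: "nat \<Rightarrow> real"
  assumes "N \<ge> 1"
    and "\<And>j. j \<in> {1..N} \<Longrightarrow> k j \<ge> 1"
    and "(\<Sum>j=1..N. k j) \<le> CARD('n)"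
    and "disjoint_family_on A {1..N}"
    and "\<And>j. j \<in> {1..N} \<Longrightarrow> card (A j) = k j"
    and "1 < p"
    and "\<And>j. j \<in> {1..N} \<Longrightarrow> 0 < \<alpha> j"
    and "\<And>j. j \<in> {1..N} \<Longrightarrow> \<alpha> j < real (k j) / p"
  shows "\<exists>C::real. C > 0 \<and>
    (\<forall>f :: real ^ 'n \<Rightarrow> complex. test_function f \<longrightarrow>
      Lp_norm p (\<lambda>x. f x / complex_of_real (\<Prod>j=1..N. \<bar>block_radius (A j) x\<bar> powr \<alpha> j))
        \<le> ennreal C * Lp_norm p (frac_deriv (\<Union>j\<in>{1..N}. A j) (\<Sum>j=1..N. \<alpha> j) f))"
proof -
  note p = assms(6)
  define B where "B = (\<Union>j\<in>{1..N}. A j)"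
  \<comment> \<open>The order \<open>\<alpha> j\<close> is shared equally among the variables of \<open>A j\<close>.\<close>
  define J where "J m = (THE j. j \<in> {1..N} \<and> m \<in> A j)" for m
  define \<gamma> where "\<gamma> m = \<alpha> (J m) / real (k (J m))" for m
  have J: "J m = j" if "j \<in> {1..N}" "m \<in> A j" for m j
    unfolding J_def using that assms(4)[unfolded disjoint_family_on_def] by (intro the_equality) blast+
  have \<gamma>A: "\<gamma> m = \<alpha> j / real (k j)" if "j \<in> {1..N}" "m \<in> A j" for m j
    using J[OF that] by (simp add: \<gamma>_def)
  have \<gamma>: "0 < \<gamma> m \<and> \<gamma> m < 1 / p" if m: "m \<in> B" for m
  proof -
    obtain j where j: "j \<in> {1..N}" "m \<in> A j" using m unfolding B_def by blast
    show ?thesis using assms(2,7,8)[OF j(1)] p by (simp add: \<gamma>A[OF j] field_simps)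
  qed
  have \<gamma>1: "0 < \<gamma> m \<and> \<gamma> m < 1" if "m \<in> B" for m
  proof -
    have "1 / p < 1" using p by simp
    then show ?thesis using \<gamma>[OF that] by linarith
  qed
  have B: "B \<noteq> {}"
  proof -
    have "1 \<in> {1..N}" using assms(1) by simp
    moreover have "A 1 \<noteq> {}" using assms(2,5)[OF \<open>1 \<in> {1..N}\<close>] by auto
    ultimately show ?thesis unfolding B_def by blast
  qed
  have finA: "\<forall>j\<in>{1..N}. finite (A j)" "\<forall>i\<in>{1..N}. \<forall>j\<in>{1..N}. i \<noteq> j \<longrightarrow> A i \<inter> A j = {}"
    using assms(4) by (auto simp: disjoint_family_on_def)
  have sum_\<gamma>: "(\<Sum>m\<in>B. \<gamma> m) = (\<Sum>j=1..N. \<alpha> j)"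
  proof -
    have "(\<Sum>m\<in>B. \<gamma> m) = (\<Sum>j=1..N. \<Sum>m\<in>A j. \<gamma> m)"
      unfolding B_def using finA by (intro sum.UNION_disjoint) auto
    also have "\<dots> = (\<Sum>j=1..N. \<alpha> j)"
    proof (intro sum.cong refl)
      fix j assume j: "j \<in> {1..N}"
      have "(\<Sum>m\<in>A j. \<gamma> m) = (\<Sum>m\<in>A j. \<alpha> j / real (k j))" using \<gamma>A[OF j] by (intro sum.cong) auto
      then show "(\<Sum>m\<in>A j. \<gamma> m) = \<alpha> j" using assms(2,5)[OF j] by simp
    qed
    finally show ?thesis .
  qed
  have weight: "inverse (\<Prod>j=1..N. \<bar>block_radius (A j) x\<bar> powr \<alpha> j) \<le> (\<Prod>m\<in>B. \<bar>x $ m\<bar> powr (- \<gamma> m))"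
    if x: "\<forall>m. x $ m \<noteq> 0" for x :: "real^'n"
  proof -
    have "inverse (\<Prod>j=1..N. \<bar>block_radius (A j) x\<bar> powr \<alpha> j) = (\<Prod>j=1..N. block_radius (A j) x powr (- \<alpha> j))"
      by (simp add: prod_inversef[symmetric] powr_minus)
    also have "\<dots> \<le> (\<Prod>j=1..N. \<Prod>m\<in>A j. \<bar>x $ m\<bar> powr (- \<gamma> m))"
    proof (intro prod_mono conjI)
      fix j assume j: "j \<in> {1..N}"
      obtain m0 where "m0 \<in> A j" using assms(2,5)[OF j] by fastforce
      then have r: "block_radius (A j) x > 0" using x by (auto intro: block_radius_pos)
      have "block_radius (A j) x powr (- \<alpha> j) = (\<Prod>m\<in>A j. block_radius (A j) x powr (- (\<alpha> j / real (k j))))"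
        using r assms(2,5)[OF j] by (simp add: powr_powr flip: powr_realpow)
      also have "\<dots> \<le> (\<Prod>m\<in>A j. \<bar>x $ m\<bar> powr (- \<gamma> m))"
      proof (intro prod_mono conjI)
        fix m assume m: "m \<in> A j"
        show "block_radius (A j) x powr (- (\<alpha> j / real (k j))) \<le> \<bar>x $ m\<bar> powr (- \<gamma> m)"
          unfolding \<gamma>A[OF j m] using x abs_coord_le_block_radius[OF m, of x] assms(7)[OF j]
          by (intro powr_mono2') auto
      qed simp
      finally show "block_radius (A j) x powr (- \<alpha> j) \<le> (\<Prod>m\<in>A j. \<bar>x $ m\<bar> powr (- \<gamma> m))" .
    qed simp
    also have "\<dots> = (\<Prod>m\<in>B. \<bar>x $ m\<bar> powr (- \<gamma> m))"
      unfolding B_def using finA by (intro prod.UNION_disjoint[symmetric]) auto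
    finally show ?thesis .
  qed
  obtain C1 where C1: "C1 > 0"
    "\<And>(f :: real ^ 'n \<Rightarrow> complex) x. test_function f \<Longrightarrow> ennreal (norm (f x)) \<le>
       (\<integral>\<^sup>+y. ennreal (riesz_gauss_kernel B \<gamma> y * (C1 * norm (frac_deriv B (\<Sum>m\<in>B. \<gamma> m) f (x - coord_proj B y)))) \<partial>lborel)"
    using pointwise_riesz_bound[where B=B and \<gamma>=\<gamma>, OF B \<gamma>1] by blast
  obtain C2 where C2: "C2 > 0"
    "\<And>h u. h \<in> borel_measurable borel \<Longrightarrow> (\<And>x. 0 \<le> h x) \<Longrightarrow> (\<And>x. 0 \<le> u x) \<Longrightarrow>
       (AE x in lborel. ennreal (u x) \<le> (\<integral>\<^sup>+y. ennreal (riesz_gauss_kernel B \<gamma> y * h (x - coord_proj B y)) \<partial>lborel)) \<Longrightarrow>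
       (\<integral>\<^sup>+x. ennreal (((\<Prod>m\<in>B. \<bar>x $ m\<bar> powr (- \<gamma> m)) * u x) powr p) \<partial>lborel)
         \<le> ennreal C2 * (\<integral>\<^sup>+x. ennreal (h x powr p) \<partial>lborel)"
    using weighted_riesz_gauss_bound[where B=B and \<gamma>=\<gamma>, OF p \<gamma>] by blast
  define C where "C = C2 * C1 powr p"
  have C: "C > 0" using C1 C2 by (simp add: C_def)
  have main: "Lp_norm p (\<lambda>x. f x / complex_of_real (\<Prod>j=1..N. \<bar>block_radius (A j) x\<bar> powr \<alpha> j))
        \<le> ennreal (C powr (1 / p)) * Lp_norm p (frac_deriv B (\<Sum>j=1..N. \<alpha> j) f)"
    if f: "test_function f" for f :: "real ^ 'n \<Rightarrow> complex"
  proof (rule Lp_norm_le[OF _ C])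
    show "p > 0" using p by simp
    note [measurable] = test_function_measurable[OF f]
    define g where "g = frac_deriv B (\<Sum>j=1..N. \<alpha> j) f"
    have [measurable]: "g \<in> borel_measurable borel" unfolding g_def frac_deriv_def by measurable
    have "(\<integral>\<^sup>+x. ennreal (norm (f x / complex_of_real (\<Prod>j=1..N. \<bar>block_radius (A j) x\<bar> powr \<alpha> j)) powr p) \<partial>lborel)
      \<le> (\<integral>\<^sup>+x. ennreal (((\<Prod>m\<in>B. \<bar>x $ m\<bar> powr (- \<gamma> m)) * norm (f x)) powr p) \<partial>lborel)"
      using AE_coord_nonzero[of "\<lambda>_. 0"]
    proof (intro nn_integral_mono_AE, eventually_elim)
      fix x :: "real^'n" assume x: "\<forall>m. x $ m \<noteq> 0"
      have "norm (f x / complex_of_real (\<Prod>j=1..N. \<bar>block_radius (A j) x\<bar> powr \<alpha> j))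
         = inverse (\<Prod>j=1..N. \<bar>block_radius (A j) x\<bar> powr \<alpha> j) * norm (f x)"
        unfolding norm_divide norm_of_real abs_of_nonneg[OF prod_powr_nonneg] by (simp only: divide_inverse mult.commute)
      also have "\<dots> \<le> (\<Prod>m\<in>B. \<bar>x $ m\<bar> powr (- \<gamma> m)) * norm (f x)"
        using weight[OF x] by (intro mult_right_mono) auto
      finally show "ennreal (norm (f x / complex_of_real (\<Prod>j=1..N. \<bar>block_radius (A j) x\<bar> powr \<alpha> j)) powr p)
         \<le> ennreal (((\<Prod>m\<in>B. \<bar>x $ m\<bar> powr (- \<gamma> m)) * norm (f x)) powr p)"
        using p by (intro ennreal_leI powr_mono2) auto
    qed
    also have "\<dots> \<le> ennreal C2 * (\<integral>\<^sup>+x. ennreal ((C1 * norm (g x)) powr p) \<partial>lborel)"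
      using C1(1) C1(2)[OF f] unfolding sum_\<gamma> g_def[symmetric] by (intro C2) auto
    also have "(\<integral>\<^sup>+x. ennreal ((C1 * norm (g x)) powr p) \<partial>lborel)
       = ennreal (C1 powr p) * (\<integral>\<^sup>+x. ennreal (norm (g x) powr p) \<partial>lborel)"
      using C1(1) by (subst nn_integral_cmult[symmetric]) (auto simp: powr_mult ennreal_mult)
    also have "ennreal C2 * \<dots> = ennreal C * (\<integral>\<^sup>+x. ennreal (norm (g x) powr p) \<partial>lborel)"
      using C2(1) by (simp add: C_def ennreal_mult mult.assoc)
    finally show "(\<integral>\<^sup>+x. ennreal (norm (f x / complex_of_real (\<Prod>j=1..N. \<bar>block_radius (A j) x\<bar> powr \<alpha> j)) powr p) \<partial>lborel)
      \<le> ennreal C * (\<integral>\<^sup>+x. ennreal (norm (frac_deriv B (\<Sum>j=1..N. \<alpha> j) f x) powr p) \<partial>lborel)"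
      unfolding g_def .
  qed
  show ?thesis
    using main C unfolding B_def by (intro exI[of _ "C powr (1 / p)"]) auto
qed

end
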